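(* Let $\mathbb{S}^1=\mathbb{R}/\mathbb{Z}$ and let $f\in C^1(\mathbb{S}^1)$, so that $\dot{x}=f(x)$ is a $C^1$ dynamical system on $\mathbb{S}^1$. Then the system $\dot{x}=f(x)$ is $C^1$ structurally stable if and only if it has finitely many fixed points, all of which are hyperbolic.
   Context: The circle is $\mathbb{S}^1=\mathbb{R}/\mathbb{Z}$, i.e. the unit interval $[0,1]$ with its end points identified. $C^1(\mathbb{S}^1)$ denotes the set of $C^1$ functions (vector fields) $f:\mathbb{S}^1\to\mathbb{R}$; equivalently, $C^1$ functions $f:\mathbb{R}\to\mathbb{R}$ with $f(x+1)=f(x)$ for all $x\in\mathbb{R}$, or $C^1$ functions $f:[0,1]\to\mathbb{R}$ with $f(0)=f(1)$ and $f'(0)=f'(1)$. Each $f\in C^1(\mathbb{S}^1)$ defines a dynamical system $\dot{x}=f(x)$ on $\mathbb{S}^1$. Fixed points: $x_*\in\mathbb{S}^1$ is a fixed point of $\dot{x}=f(x)$ if $f(x_* )=0$; it is hyperbolic if $f'(x_* )\neq 0$, and nonhyperbolic otherwise. "Finitely many" includes the case of no fixed points. Topological equivalence: two dynamical systems $\dot{x}=f(x)$ and $\dot{y}=g(y)$ on $\mathbb{S}^1$ are topologically equivalent if there is a homeomorphism $h:\mathbb{S}^1\to\mathbb{S}^1$ that maps the orbits of the first system, oriented by increasing time, onto the orbits of the second system, oriented by increasing time (preserving these time orientations). $C^1$ norm and balls: for $f\in C^1(\mathbb{S}^1)$, $\|f\|_1:=\sup\{|f(x)|:x\in\mathbb{S}^1\}+\sup\{|f'(x)|:x\in\mathbb{S}^1\}$,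 and $B^1_\epsilon(f):=\{g\in C^1(\mathbb{S}^1):\|g-f\|_1<\epsilon\}$. Structural stability: the system $\dot{x}=f(x)$ with $f\in C^1(\mathbb{S}^1)$ is $C^1$ structurally stable if for every sufficiently small $\epsilon>0$, for all $g\in B^1_\epsilon(f)$ the system $\dot{y}=g(y)$ is topologically equivalent to $\dot{x}=f(x)$. *)

theory Defs
  imports "HOL-Analysis.Analysis"
begin

quotient_type circle = real / "\<lambda>x y :: real. x - y \<in> \<int>"
  morphisms rep_circle circle_of
proof (rule equivpI)
  show "reflp (\<lambda>x y :: real. x - y \<in> \<int>)"
    by (simp add: reflp_def)
  show "symp (\<lambda>x y :: real. x - y \<in> \<int>)"
    by (metis (no_types, lifting) Ints_minus minus_diff_eq sympI)
  show "transp (\<lambda>x y :: real. x - y \<in> \<int>)"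
  proof (rule transpI)
    fix x y z :: real
    assume "x - y \<in> \<int>" "y - z \<in> \<int>"
    then have "(x - y) + (y - z) \<in> \<int>" by (rule Ints_add)
    then show "x - z \<in> \<int>" by simp
  qed
qed

lemma circle_of_eq_iff: "circle_of x = circle_of y \<longleftrightarrow> x - y \<in> \<int>"
  by (simp add: circle.abs_eq_iff)

lemma circle_of_rep_circle [simp]: "circle_of (rep_circle p) = p"
  using Quotient3_abs_rep[OF Quotient3_circle] .

instantiation circle :: topological_space
begin

definition open_circle_def: "open U \<longleftrightarrow> open (circle_of -` U)"

instance
  by standard (auto simp: open_circle_def vimage_Union intro!: open_INT open_UN)

end

definition C1_circle :: "(circle \<Rightarrow> real) set" where
  "C1_circle = {f. (\<lambda>x. f (circle_of x)) C1_differentiable_on UNIV}"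

text \<open>
  The derivative is taken at a chosen representative; by periodicity the choice is irrelevant
  (lemma \<open>circle_deriv_circle_of\<close> below).
\<close>

definition circle_deriv :: "(circle \<Rightarrow> real) \<Rightarrow> circle \<Rightarrow> real" where
  "circle_deriv f p = deriv (\<lambda>x. f (circle_of x)) (rep_circle p)"

lemma circle_deriv_circle_of:
  "circle_deriv f (circle_of x) = deriv (\<lambda>t. f (circle_of t)) x"
proof -
  define y where "y = rep_circle (circle_of x)"
  have "circle_of y = circle_of x" by (simp add: y_def)
  then have yx: "y - x \<in> \<int>" by (simp add: circle_of_eq_iff)
  have per: "f (circle_of (t + (y - x))) = f (circle_of t)" for t
  proof -
    have "circle_of (t + (y - x)) = circle_of t" using yx by (simp add: circle_of_eq_iff)
    then show ?thesis by simp
  qed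
  have "((\<lambda>t. f (circle_of t)) has_field_derivative D) (at y) \<longleftrightarrow>
        ((\<lambda>t. f (circle_of t)) has_field_derivative D) (at x)" for D
    using DERIV_shift[of "\<lambda>t. f (circle_of t)" D x "y - x"] per by simp
  then have "deriv (\<lambda>t. f (circle_of t)) y = deriv (\<lambda>t. f (circle_of t)) x"
    by (simp add: deriv_def)
  then show ?thesis by (simp add: circle_deriv_def y_def)
qed

definition fixed_points :: "(circle \<Rightarrow> real) \<Rightarrow> circle set" where
  "fixed_points f = {p. f p = 0}"

definition hyperbolic :: "(circle \<Rightarrow> real) \<Rightarrow> circle \<Rightarrow> bool" where
  "hyperbolic f p \<longleftrightarrow> circle_deriv f p \<noteq> 0"

text \<open>
  A solution on the circle is the projection of a solution \<open>u\<close> of the lifted equation on the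
  real line.  Since a \<open>C\<^sup>1\<close> vector field on the circle is bounded and Lipschitz, all maximal
  solutions are defined for all times, so only these are considered.
\<close>

definition solution :: "(circle \<Rightarrow> real) \<Rightarrow> (real \<Rightarrow> circle) \<Rightarrow> bool" where
  "solution f \<gamma> \<longleftrightarrow>
     (\<exists>u. (\<forall>t. (u has_real_derivative f (circle_of (u t))) (at t)) \<and>
          (\<forall>t. \<gamma> t = circle_of (u t)))"

definition orbits :: "(circle \<Rightarrow> real) \<Rightarrow> circle set set" where
  "orbits f = {range \<gamma> | \<gamma>. solution f \<gamma>}"

text \<open>
  The map \<open>h\<close> respects the orientation of orbits by increasing time if it carries every solution
  to a solution up to an increasing change of the time parameter \<open>\<tau>\<close>.  A strictly increasing
  surjection of the real line is automatically a homeomorphism.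
\<close>

definition preserves_time_orientation ::
    "(circle \<Rightarrow> circle) \<Rightarrow> (circle \<Rightarrow> real) \<Rightarrow> (circle \<Rightarrow> real) \<Rightarrow> bool" where
  "preserves_time_orientation h f g \<longleftrightarrow>
     (\<forall>\<gamma>. solution f \<gamma> \<longrightarrow>
        (\<exists>\<delta> \<tau>. solution g \<delta> \<and> strict_mono (\<tau> :: real \<Rightarrow> real) \<and> surj \<tau> \<and>
               (\<forall>t. h (\<gamma> t) = \<delta> (\<tau> t))))"

definition topologically_equivalent ::
    "(circle \<Rightarrow> real) \<Rightarrow> (circle \<Rightarrow> real) \<Rightarrow> bool" where
  "topologically_equivalent f g \<longleftrightarrow>
     (\<exists>h. homeomorphic_map euclidean euclidean h \<and>
          (\<lambda>A. h ` A) ` orbits f = orbits g \<and>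
          preserves_time_orientation h f g)"

definition C1_norm :: "(circle \<Rightarrow> real) \<Rightarrow> real" where
  "C1_norm f = (SUP p. \<bar>f p\<bar>) + (SUP p. \<bar>circle_deriv f p\<bar>)"

definition C1_ball :: "real \<Rightarrow> (circle \<Rightarrow> real) \<Rightarrow> (circle \<Rightarrow> real) set" where
  "C1_ball \<epsilon> f = {g \<in> C1_circle. C1_norm (\<lambda>p. g p - f p) < \<epsilon>}"

definition C1_structurally_stable :: "(circle \<Rightarrow> real) \<Rightarrow> bool" where
  "C1_structurally_stable f \<longleftrightarrow>
     (\<forall>\<^sub>F \<epsilon> in at_right 0. \<forall>g \<in> C1_ball \<epsilon> f. topologically_equivalent f g)"

end

theory Submission
  imports Defs
begin

text \<open>
  A vector field \<open>f\<close> on the circle is studied through its lift \<open>F x = f (circle_of x)\<close>, a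
  1-periodic function on the line.

  \<^bold>\<open>Only the sign of \<open>F\<close> matters.\<close>  By uniqueness, a solution of \<open>u' = F u\<close> that meets a zero of
  \<open>F\<close> is constant.  Any other solution runs monotonically through the whole interval between the
  two neighbouring zeros, because time is the integral of \<open>1 / F\<close> and this integral diverges at a zero
  of a Lipschitz function (\<open>positive_solution_exists\<close>).  Hence an increasing
  bijection \<open>H\<close> of the line that commutes with the unit translation and takes the sign of \<open>F\<close> to
  the sign of \<open>G\<close> descends to a topological equivalence
  (\<open>topologically_equivalent_if_sign_conjugacy\<close>): the speeds differ, but time may be
  reparametrised.

  \<^bold>\<open>Hyperbolic zeros give stability.\<close>  By compactness there are \<open>\<delta>, m > 0\<close> such that, within
  distance \<open>\<delta>\<close> of a zero, \<open>F'\<close> has constant sign and \<open>\<bar>F'\<bar> \<ge> m\<close>, and such that \<open>\<bar>F\<bar> \<ge> m\<close>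
  elsewhere (\<open>hyperbolic_zeros_uniform\<close>).  A field \<open>G\<close> closer to \<open>F\<close> than \<open>m\<close> in the \<open>C\<^sup>1\<close> norm then
  has exactly one zero near each zero of \<open>F\<close>, crosses there in the same direction, and has the sign
  of \<open>F\<close> elsewhere.  The map \<open>H\<close> pushes each zero of \<open>F\<close> to the adjacent zero of \<open>G\<close> by a
  tent-shaped displacement (\<open>hyperbolic_imp_stable\<close>).

  \<^bold>\<open>Stability forces hyperbolic zeros.\<close>  Fixed points are the one-point orbits, so an equivalence
  preserves their number (\<open>finite_fixed_points_equivalent\<close>).  By Sard's theorem, \<open>f\<close> minus an arbitrarily
  small constant has only hyperbolic fixed points, hence finitely many; so a stable \<open>f\<close> has
  finitely many.  But if some fixed point of \<open>f\<close> were nonhyperbolic, \<open>f\<close> could be flattened to zero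
  on an interval around it by a \<open>C\<^sup>1\<close>-small change (\<open>nonhyperbolic_perturbation\<close>), and a stable \<open>f\<close>
  would have infinitely many.
\<close>

section \<open>Scalar autonomous equations on the line\<close>

definition solves :: "(real \<Rightarrow> real) \<Rightarrow> (real \<Rightarrow> real) \<Rightarrow> bool" where
  "solves F u \<longleftrightarrow> (\<forall>t. (u has_real_derivative F (u t)) (at t))"

lemma solves_reverse: "solves F u \<Longrightarrow> solves (\<lambda>x. - F x) (\<lambda>t. u (- t))"
  unfolding solves_def
proof
  fix t assume "\<forall>t. (u has_real_derivative F (u t)) (at t)"
  then have "((\<lambda>t. u (- t)) has_real_derivative F (u (- t)) * - 1) (at t)"
    by (intro DERIV_chain2[where f=u]) (auto intro!: derivative_eq_intros)
  then show "((\<lambda>t. u (- t)) has_real_derivative - F (u (- t))) (at t)" by simp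
qed

text \<open>
  Gronwall's argument: the Lipschitz bound lets \<open>(u - v)\<^sup>2\<close> grow at most like \<open>exp (2 * L * t)\<close>,
  and it starts at zero.
\<close>

lemma solution_unique_right:
  assumes "solves F u" "solves F v" "u 0 = v 0" "t \<ge> 0"
    and lip: "\<And>x y. \<bar>F x - F y\<bar> \<le> L * \<bar>x - y\<bar>"
  shows "u t = v t"
proof -
  define w where "w t = (u t - v t)\<^sup>2 * exp (- 2 * L * t)" for t
  have "w t \<le> w 0"
  proof (rule DERIV_nonpos_imp_nonincreasing[OF \<open>t \<ge> 0\<close>])
    fix s
    let ?D = "(2 * (u s - v s) * (F (u s) - F (v s)) - 2 * L * (u s - v s)\<^sup>2) * exp (- 2 * L * s)"
    have "(w has_real_derivative ?D) (at s)"
      unfolding w_def using assms(1,2)[unfolded solves_def]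
      by (auto intro!: derivative_eq_intros simp: algebra_simps power2_eq_square)
    moreover have "(u s - v s) * (F (u s) - F (v s)) \<le> L * (u s - v s)\<^sup>2"
    proof -
      have "(u s - v s) * (F (u s) - F (v s)) \<le> \<bar>u s - v s\<bar> * \<bar>F (u s) - F (v s)\<bar>"
        by (metis abs_ge_self abs_mult)
      also have "\<dots> \<le> \<bar>u s - v s\<bar> * (L * \<bar>u s - v s\<bar>)"
        by (intro mult_left_mono lip) auto
      also have "\<dots> = L * (u s - v s)\<^sup>2"
        by (simp add: power2_eq_square)
      finally show ?thesis .
    qed
    then have "?D \<le> 0"
      by (intro mult_nonpos_nonneg) (simp_all only: mult.assoc, simp_all)
    ultimately show "\<exists>y. (w has_real_derivative y) (at s) \<and> y \<le> 0" by blast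
  qed
  then have "(u t - v t)\<^sup>2 * exp (- 2 * L * t) \<le> 0"
    using assms(3) by (simp add: w_def)
  then show ?thesis
    by (simp add: mult_le_0_iff)
qed

lemma solution_unique:
  assumes u: "solves F u" and v: "solves F v" and "u 0 = v 0"
    and lip: "\<And>x y. \<bar>F x - F y\<bar> \<le> L * \<bar>x - y\<bar>"
  shows "u = v"
proof
  fix t
  show "u t = v t"
  proof (cases "t \<ge> 0")
    case True
    then show ?thesis using solution_unique_right[OF u v _ _ lip] assms(3) by blast
  next
    case False
    have "u (- (- t)) = v (- (- t))"
    proof (rule solution_unique_right[OF solves_reverse[OF u] solves_reverse[OF v], where t="-t" and L=L])
      show "\<bar>- F x - - F y\<bar> \<le> L * \<bar>x - y\<bar>" for x y
        using lip[of x y] by (simp add: abs_minus_commute)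
    qed (use False assms(3) in auto)
    then show ?thesis by simp
  qed
qed

text \<open>
  This is why a solution takes infinite time to leave its interval: \<open>\<Phi>\<close> is the time needed to travel.
  At a finite end \<open>\<beta>\<close>, which is a zero, the Lipschitz bound gives \<open>F x \<le> K * (\<beta> - x)\<close>, so the time grows
  at least like \<open>- ln (\<beta> - x) / K\<close>; towards an infinite end the speed is at most \<open>B\<close>.
\<close>

lemma antiderivative_unbounded_right:
  fixes b :: ereal
  assumes lip: "\<And>x y. \<bar>F x - F y\<bar> \<le> L * \<bar>x - y\<bar>"
    and x0: "ereal x0 < b"
    and pos: "\<And>x. x0 \<le> x \<Longrightarrow> ereal x < b \<Longrightarrow> F x > 0"
    and end_zero: "\<And>\<beta>. b = ereal \<beta> \<Longrightarrow> F \<beta> = 0"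
    and der: "\<And>x. x0 \<le> x \<Longrightarrow> ereal x < b \<Longrightarrow> (\<Phi> has_real_derivative 1 / F x) (at x)"
    and bdd: "\<And>x. F x \<le> B"
  shows "\<exists>x. x0 \<le> x \<and> ereal x < b \<and> M \<le> \<Phi> x"
proof (rule ccontr)
  assume "\<not> ?thesis"
  then have bound: "\<Phi> x < M" if "x0 \<le> x" "ereal x < b" for x
    using that by force
  have B: "B > 0" using pos[of x0] bdd[of x0] x0 by force
  have L: "L \<ge> 0"
    using lip[of 0 1] by (smt (verit) mult_cancel_left1)
  show False
  proof (cases b)
    case (real \<beta>)
    (* The extra 1 makes K positive even when F is constant and L = 0. *)
    define K where "K = L + 1"
    have K: "K > 0" using L by (simp add: K_def)
    have x0\<beta>: "x0 < \<beta>" using x0 real by simp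
    (* Chosen so that ln (\<beta> - y) = ln (\<beta> - x0) - K * (M - \<Phi> x0): at y the travel time must have reached M. *)
    define y where "y = \<beta> - (\<beta> - x0) * exp (- K * (M - \<Phi> x0))"
    have "M - \<Phi> x0 > 0" using bound[of x0] x0 by simp
    then have "exp (- K * (M - \<Phi> x0)) < 1" using K by simp
    then have "(\<beta> - x0) * exp (- K * (M - \<Phi> x0)) < \<beta> - x0"
      using x0\<beta> by (simp del: exp_less_one_iff)
    then have "x0 < y" unfolding y_def by linarith
    moreover have "y < \<beta>" using x0\<beta> by (simp add: y_def)
    ultimately have y: "x0 < y" "y < \<beta>" by auto
    have "K * \<Phi> x0 + ln (\<beta> - x0) \<le> K * \<Phi> y + ln (\<beta> - y)"
    proof (rule DERIV_nonneg_imp_nondecreasing[where f="\<lambda>x. K * \<Phi> x + ln (\<beta> - x)"])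
      show "x0 \<le> y" using y by simp
      fix x assume x: "x0 \<le> x" "x \<le> y"
      have xb: "ereal x < b" "x < \<beta>" using x y real by auto
      have Fx: "F x > 0" using pos x xb by auto
      have "((\<lambda>x. K * \<Phi> x + ln (\<beta> - x)) has_real_derivative K * (1 / F x) - 1 / (\<beta> - x)) (at x)"
        using xb by (auto intro!: derivative_eq_intros der x)
      moreover have "F x \<le> K * (\<beta> - x)"
        using lip[of x \<beta>] end_zero[OF real] xb Fx L by (simp add: K_def algebra_simps)
      then have "K * (1 / F x) - 1 / (\<beta> - x) \<ge> 0"
        using Fx xb by (simp add: field_simps)
      ultimately show "\<exists>y. ((\<lambda>x. K * \<Phi> x + ln (\<beta> - x)) has_real_derivative y) (at x) \<and> 0 \<le> y"
        by blast
    qed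
    also have "ln (\<beta> - y) = ln (\<beta> - x0) - K * (M - \<Phi> x0)"
      using x0\<beta> by (simp add: y_def ln_mult)
    finally have "K * M \<le> K * \<Phi> y" by (simp add: algebra_simps)
    then have "M \<le> \<Phi> y" using K by simp
    with bound[of y] y real show False by auto
  next
    case PInf
    (* At speed at most B the travel time from x0 to y is at least M - \<Phi> x0. *)
    define y where "y = x0 + B * (M - \<Phi> x0)"
    have "M - \<Phi> x0 > 0" using bound[of x0] x0 by simp
    then have y: "x0 \<le> y" using B by (simp add: y_def)
    have "\<Phi> x0 - x0 / B \<le> \<Phi> y - y / B"
    proof (rule DERIV_nonneg_imp_nondecreasing[where f="\<lambda>x. \<Phi> x - x / B", OF y])
      fix x assume x: "x0 \<le> x" "x \<le> y"
      have Fx: "F x > 0" using pos x PInf by auto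
      have "((\<lambda>x. \<Phi> x - x / B) has_real_derivative 1 / F x - 1 / B) (at x)"
        using B PInf x by (auto intro!: derivative_eq_intros der)
      moreover have "1 / F x - 1 / B \<ge> 0"
        using Fx bdd[of x] B by (simp add: field_simps)
      ultimately show "\<exists>y. ((\<lambda>x. \<Phi> x - x / B) has_real_derivative y) (at x) \<and> 0 \<le> y"
        by blast
    qed
    then have "M \<le> \<Phi> y" using B by (simp add: y_def field_simps)
    with bound[of y] y PInf show False by auto
  next
    case MInf
    then show False using x0 by simp
  qed
qed


text \<open>
  The right end of the interval of positivity around \<open>x0\<close> is the first zero after \<open>x0\<close>, or \<open>\<infinity>\<close>.
  Extended reals keep both cases in one statement.
\<close>

lemma positivity_endpoint_right:
  fixes F :: "real \<Rightarrow> real"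
  assumes cont: "continuous_on UNIV F" and pos: "F x0 > 0"
  obtains b :: ereal where "ereal x0 < b"
    "\<And>x. x0 \<le> x \<Longrightarrow> ereal x < b \<longleftrightarrow> (\<forall>z\<in>{x0..x}. F z > 0)"
    "\<And>\<beta>. b = ereal \<beta> \<Longrightarrow> F \<beta> = 0"
proof -
  define S where "S = {z. x0 \<le> z \<and> F z = 0}"
  have zero_iff: "(\<forall>z\<in>{x0..x}. F z > 0) \<longleftrightarrow> (\<forall>z\<in>S. x < z)" if "x0 \<le> x" for x
  proof
    assume "\<forall>z\<in>{x0..x}. F z > 0"
    then show "\<forall>z\<in>S. x < z" by (force simp: S_def)
  next
    assume S: "\<forall>z\<in>S. x < z"
    show "\<forall>z\<in>{x0..x}. F z > 0"
    proof (rule ballI, rule ccontr)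
      fix z assume z: "z \<in> {x0..x}" "\<not> F z > 0"
      have "\<exists>y\<ge>x0. y \<le> z \<and> F y = 0"
        by (rule IVT2') (use z pos cont in \<open>auto intro: continuous_on_subset\<close>)
      with S z show False by (force simp: S_def)
    qed
  qed
  show thesis
  proof (cases "S = {}")
    case True
    show thesis by (rule that[of \<infinity>]) (use zero_iff True in auto)
  next
    case False
    have "closed S"
      unfolding S_def by (intro closed_Collect_conj closed_Collect_le closed_Collect_eq continuous_intros cont)
    moreover have bdd: "bdd_below S" by (auto simp: S_def)
    ultimately have Inf: "Inf S \<in> S" using False closed_contains_Inf by blast
    then have "x0 < Inf S" using pos by (auto simp: S_def less_le)
    moreover have "x < Inf S \<longleftrightarrow> (\<forall>z\<in>S. x < z)" for x
      using Inf bdd by (metis cInf_lower less_le_trans)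
    ultimately show thesis
      by (intro that[of "ereal (Inf S)"]) (use zero_iff Inf in \<open>auto simp: S_def\<close>)
  qed
qed

text \<open>
  The connected component of \<open>x0\<close> in \<open>{x. F x > 0}\<close>, written with segments so that an increasing
  map visibly carries components to components.
\<close>

definition pos_component :: "(real \<Rightarrow> real) \<Rightarrow> real \<Rightarrow> real set" where
  "pos_component F x0 = {x. \<forall>z\<in>closed_segment x0 x. F z > 0}"

text \<open>
  The solution is the inverse of the travel time \<open>\<Phi>\<close>, an antiderivative of \<open>1 / F\<close> on the component of
  \<open>x0\<close>.  Since \<open>\<Phi>\<close> is unbounded at both ends, it maps the component onto the line; so the solution
  exists for all times and sweeps out the whole component.
\<close>

lemma positive_solution_exists:
  fixes F :: "real \<Rightarrow> real"
  assumes lip: "\<And>x y. \<bar>F x - F y\<bar> \<le> L * \<bar>x - y\<bar>"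
    and bdd: "\<And>x. F x \<le> B"
    and pos: "F x0 > 0"
  obtains v where "solves F v" "v 0 = x0" "strict_mono v" "range v = pos_component F x0"
proof -
  have cont: "continuous_on UNIV F"
  proof -
    have L: "L \<ge> 0"
      using lip[of 0 1] by (smt (verit) mult_cancel_left1)
    show ?thesis
      by (rule lipschitz_on_continuous_on[OF lipschitz_onI[OF _ L]]) (use lip in \<open>auto simp: dist_real_def\<close>)
  qed
  obtain b :: ereal where b: "ereal x0 < b"
    "\<And>x. x0 \<le> x \<Longrightarrow> ereal x < b \<longleftrightarrow> (\<forall>z\<in>{x0..x}. F z > 0)"
    "\<And>\<beta>. b = ereal \<beta> \<Longrightarrow> F \<beta> = 0"
    using positivity_endpoint_right[OF cont pos] by blast
  (* The left end of the component is the right end for the reflected function. *)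
  obtain a' :: ereal where a': "ereal (- x0) < a'"
    "\<And>x. - x0 \<le> x \<Longrightarrow> ereal x < a' \<longleftrightarrow> (\<forall>z\<in>{- x0..x}. F (- z) > 0)"
    "\<And>\<beta>. a' = ereal \<beta> \<Longrightarrow> F (- \<beta>) = 0"
    by (rule positivity_endpoint_right[of "\<lambda>x. F (- x)" "- x0"])
      (use pos in \<open>auto intro!: continuous_on_compose2[OF cont] continuous_intros\<close>)
  define a where "a = - a'"
  have a_less: "a < ereal x \<longleftrightarrow> ereal (- x) < a'" for x
    unfolding a_def by (cases a') auto
  have a: "a < ereal x0"
    using a' by (simp add: a_less)
  have above_a: "a < ereal y" if "x0 \<le> y" for y
    using a that by (meson ereal_less_eq(3) less_le_trans)
  have below_b: "ereal y < b" if "y \<le> x0" for y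
    using b(1) that by (meson ereal_less_eq(3) le_less_trans)
  have a_iff: "a < ereal x \<longleftrightarrow> (\<forall>z\<in>{x..x0}. F z > 0)" if "x \<le> x0" for x
  proof -
    have "a < ereal x \<longleftrightarrow> ereal (- x) < a'"
      by (rule a_less)
    also have "\<dots> \<longleftrightarrow> (\<forall>z\<in>{- x0..- x}. F (- z) > 0)"
      using that by (intro a') simp
    also have "\<dots> \<longleftrightarrow> (\<forall>z\<in>{x..x0}. F z > 0)"
      by (metis atLeastAtMost_iff minus_le_iff minus_minus neg_le_iff_le)
    finally show ?thesis .
  qed
  have J: "x \<in> pos_component F x0 \<longleftrightarrow> a < ereal x \<and> ereal x < b" for x
  proof (cases "x0 \<le> x")
    case True
    then have "a < ereal x" by (rule above_a)
    then show ?thesis using True b(2)[OF True] by (simp add: pos_component_def closed_segment_eq_real_ivl)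
  next
    case False
    then have "ereal x < b" by (intro below_b) simp
    then show ?thesis using False a_iff[of x] by (simp add: pos_component_def closed_segment_eq_real_ivl)
  qed
  let ?J = "pos_component F x0"
  have FJ: "F x > 0" if "x \<in> ?J" for x
    using that by (auto simp: pos_component_def)
  have "\<exists>\<Phi>. \<forall>x. a < ereal x \<longrightarrow> ereal x < b \<longrightarrow> (\<Phi> has_vector_derivative 1 / F x) (at x)"
  proof (rule einterval_antiderivative)
    show "a < b" using less_trans[OF a b(1)] .
    fix x assume "a < ereal x" "ereal x < b"
    then have "F x > 0" using FJ J by blast
    then show "isCont (\<lambda>x. 1 / F x) x"
      using cont by (auto intro!: continuous_intros simp: continuous_on_eq_continuous_at)
  qed
  then obtain \<Phi> where \<Phi>: "(\<Phi> has_real_derivative 1 / F x) (at x)" if "x \<in> ?J" for x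
    unfolding J has_real_derivative_iff_has_vector_derivative by blast
  have conv: "z \<in> ?J" if "x \<in> ?J" "y \<in> ?J" "x \<le> z" "z \<le> y" for x y z
    using that unfolding J by (meson ereal_less_eq(3) le_less_trans less_le_trans)
  have x0J: "x0 \<in> ?J" using J a b by blast
  have mono: "\<Phi> x < \<Phi> y" if "x \<in> ?J" "y \<in> ?J" "x < y" for x y
  proof (rule DERIV_pos_imp_increasing[OF \<open>x < y\<close>])
    fix z assume "x \<le> z" "z \<le> y"
    then have "z \<in> ?J" using conv that by blast
    then show "\<exists>y. (\<Phi> has_real_derivative y) (at z) \<and> 0 < y"
      using \<Phi> FJ by (intro exI[of _ "1 / F z"]) auto
  qed
  have surj: "\<exists>x\<in>?J. \<Phi> x = t" for t
  proof -
    have "\<exists>x. x0 \<le> x \<and> ereal x < b \<and> t \<le> \<Phi> x"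
    proof (rule antiderivative_unbounded_right[OF lip b(1) _ b(3) _ bdd])
      fix x assume "x0 \<le> x" "ereal x < b"
      then have "x \<in> ?J" unfolding J using above_a by blast
      then show "F x > 0" "(\<Phi> has_real_derivative 1 / F x) (at x)" using \<Phi> FJ by auto
    qed auto
    then obtain y where y: "x0 \<le> y" "ereal y < b" "t \<le> \<Phi> y" by blast
    have "\<exists>x. - x0 \<le> x \<and> ereal x < a' \<and> - t \<le> - \<Phi> (- x)"
    proof (rule antiderivative_unbounded_right[where F="\<lambda>x. F (- x)", OF _ a'(1) _ a'(3)])
      show "\<bar>F (- x) - F (- y)\<bar> \<le> L * \<bar>x - y\<bar>" for x y
        using lip[of "-x" "-y"] by (simp add: abs_minus_commute)
      fix x assume "- x0 \<le> x" "ereal x < a'"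
      then have "a < ereal (- x)" "ereal (- x) < b"
        using below_b[of "- x"] by (auto simp: a_less)
      then have *: "- x \<in> ?J" unfolding J by blast
      show "F (- x) > 0" using FJ * by blast
      have "((\<lambda>x. - \<Phi> (- x)) has_real_derivative - (1 / F (- x) * - 1)) (at x)"
        by (intro DERIV_minus DERIV_chain2[where f=\<Phi>] \<Phi> *) (auto intro!: derivative_eq_intros)
      then show "((\<lambda>x. - \<Phi> (- x)) has_real_derivative 1 / F (- x)) (at x)" by simp
    qed (use bdd in auto)
    then obtain x where x: "- x0 \<le> x" "ereal x < a'" "- t \<le> - \<Phi> (- x)" by blast
    have "- x \<in> ?J" "y \<in> ?J" unfolding J
      using x y above_a[of y] below_b[of "- x"] by (auto simp: a_less)
    moreover have "\<exists>z\<ge>- x. z \<le> y \<and> \<Phi> z = t"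
    proof (rule IVT')
      show "continuous_on {- x..y} \<Phi>"
        using DERIV_isCont[OF \<Phi>] conv[OF calculation] by (intro continuous_at_imp_continuous_on) simp
    qed (use x y in auto)
    ultimately show ?thesis using conv by blast
  qed
  (* The shift by \<Phi> x0 makes the solution start at x0. *)
  define v where "v t = (SOME x. x \<in> ?J \<and> \<Phi> x = t + \<Phi> x0)" for t
  have v: "v t \<in> ?J" "\<Phi> (v t) = t + \<Phi> x0" for t
  proof -
    have "\<exists>x. x \<in> ?J \<and> \<Phi> x = t + \<Phi> x0" using surj by blast
    from someI_ex[OF this] show "v t \<in> ?J" "\<Phi> (v t) = t + \<Phi> x0" by (auto simp: v_def)
  qed
  have inj: "x = y" if "x \<in> ?J" "y \<in> ?J" "\<Phi> x = \<Phi> y" for x y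
    using mono that by (metis less_irrefl linorder_neqE_linordered_idom)
  show thesis
  proof (rule that)
    show v0: "v 0 = x0" using inj v x0J by simp
    show smono: "strict_mono v"
    proof (rule strict_monoI)
      fix s t :: real assume "s < t"
      then show "v s < v t"
        using v mono by (metis add_less_cancel_right not_less_iff_gr_or_eq)
    qed
    show ran: "range v = ?J"
    proof
      show "?J \<subseteq> range v"
      proof
        fix x assume x: "x \<in> ?J"
        then have "x = v (\<Phi> x - \<Phi> x0)" using inj v by simp
        then show "x \<in> range v" by blast
      qed
    qed (use v in blast)
    have "open ?J"
    proof -
      have "?J = einterval a b" using J by (auto simp: einterval_def)
      then show ?thesis by simp
    qed
    then have "continuous_on UNIV v"
      using ran smono by (intro continuous_onI_mono) (auto simp: strict_mono_less_eq)
    then have cv: "isCont v t" for t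
      by (simp add: continuous_on_eq_continuous_at)
    show "solves F v"
      unfolding solves_def
    proof
      fix t
      have "(v has_real_derivative inverse (1 / F (v t))) (at t)"
      proof (rule DERIV_inverse_function[where f="\<lambda>x. \<Phi> x - \<Phi> x0" and a="t-1" and b="t+1"])
        show "((\<lambda>x. \<Phi> x - \<Phi> x0) has_real_derivative 1 / F (v t)) (at (v t))"
          using \<Phi>[OF v(1)] by (auto intro!: derivative_eq_intros)
      qed (use FJ[OF v(1)[of t]] v cv in auto)
      then show "(v has_real_derivative F (v t)) (at t)" by simp
    qed
  qed
qed

section \<open>Transport of solutions by maps that preserve the sign\<close>

definition bounded_lipschitz :: "(real \<Rightarrow> real) \<Rightarrow> bool" where
  "bounded_lipschitz F \<longleftrightarrow>
     (\<exists>L. \<forall>x y. \<bar>F x - F y\<bar> \<le> L * \<bar>x - y\<bar>) \<and> (\<exists>B. \<forall>x. \<bar>F x\<bar> \<le> B)"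

lemma bounded_lipschitz_uminus: "bounded_lipschitz F \<Longrightarrow> bounded_lipschitz (\<lambda>x. - F x)"
  unfolding bounded_lipschitz_def by (simp add: abs_minus_commute)

definition sign_conjugacy :: "(real \<Rightarrow> real) \<Rightarrow> (real \<Rightarrow> real) \<Rightarrow> (real \<Rightarrow> real) \<Rightarrow> bool" where
  "sign_conjugacy H F G \<longleftrightarrow> strict_mono H \<and> surj H \<and> (\<forall>x. sgn (G (H x)) = sgn (F x))"

lemma pos_component_sign_conjugacy:
  assumes "sign_conjugacy H F G"
  shows "pos_component G (H x) = H ` pos_component F x"
proof -
  have mono: "H x \<le> H y \<longleftrightarrow> x \<le> y" for x y
    using assms by (simp add: sign_conjugacy_def strict_mono_less_eq)
  have surj: "\<exists>x. y = H x" for y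
    using assms by (meson sign_conjugacy_def surjD)
  have pos: "G (H x) > 0 \<longleftrightarrow> F x > 0" for x
    using assms by (metis sign_conjugacy_def sgn_greater)
  have *: "H y \<in> pos_component G (H x) \<longleftrightarrow> y \<in> pos_component F x" for y
  proof -
    have "(\<forall>z\<in>closed_segment (H x) (H y). G z > 0) \<longleftrightarrow>
        (\<forall>z. H z \<in> closed_segment (H x) (H y) \<longrightarrow> G (H z) > 0)"
      using surj by (intro iffI allI impI ballI) (blast, metis)
    then show ?thesis
      unfolding pos_component_def mem_Collect_eq by (simp add: closed_segment_eq_real_ivl mono pos Ball_def)
  qed
  show ?thesis
  proof
    show "pos_component G (H x) \<subseteq> H ` pos_component F x"
    proof
      fix y assume "y \<in> pos_component G (H x)"
      then show "y \<in> H ` pos_component F x" using surj[of y] * by blast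
    qed
  qed (use * in blast)
qed

text \<open>
  The solutions \<open>u\<close> and \<open>v\<close> are increasing bijections onto components that \<open>H\<close> maps to one another, so
  the time change can only be \<open>v\<^sup>-\<^sup>1 \<circ> H \<circ> u\<close>.
\<close>

lemma solution_transport_pos:
  assumes F: "bounded_lipschitz F" and G: "bounded_lipschitz G"
    and H: "sign_conjugacy H F G" and u: "solves F u" and pos: "F (u 0) > 0"
  shows "\<exists>v \<tau>. solves G v \<and> strict_mono \<tau> \<and> surj \<tau> \<and> (\<forall>t. H (u t) = v (\<tau> t))"
proof -
  obtain L B where LB: "\<And>x y. \<bar>F x - F y\<bar> \<le> L * \<bar>x - y\<bar>" "\<And>x. F x \<le> B"
    using F unfolding bounded_lipschitz_def by (metis abs_le_D1)
  obtain L' B' where LB': "\<And>x y. \<bar>G x - G y\<bar> \<le> L' * \<bar>x - y\<bar>" "\<And>x. G x \<le> B'"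
    using G unfolding bounded_lipschitz_def by (metis abs_le_D1)
  have posG: "G (H (u 0)) > 0"
    using H pos by (metis sign_conjugacy_def sgn_greater)
  obtain w where w: "solves F w" "w 0 = u 0" "strict_mono w" "range w = pos_component F (u 0)"
    using positive_solution_exists[OF LB pos] by blast
  have wu: "w = u" by (rule solution_unique[OF w(1) u w(2) LB(1)])
  obtain v where v: "solves G v" "v 0 = H (u 0)" "strict_mono v" "range v = pos_component G (H (u 0))"
    using positive_solution_exists[OF LB' posG] by blast
  have ran: "range v = H ` range u"
    using pos_component_sign_conjugacy[OF H] v w wu by simp
  have Hmono: "strict_mono H" using H by (simp add: sign_conjugacy_def)
  define \<tau> where "\<tau> t = inv v (H (u t))" for t
  have v\<tau>: "v (\<tau> t) = H (u t)" for t
    unfolding \<tau>_def by (rule f_inv_into_f) (use ran in blast)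
  show ?thesis
  proof (intro exI conjI allI)
    show "strict_mono \<tau>"
    proof (rule strict_monoI)
      fix s t :: real assume "s < t"
      then have "v (\<tau> s) < v (\<tau> t)"
        using w(3) Hmono by (simp add: v\<tau> wu strict_mono_less)
      then show "\<tau> s < \<tau> t" using v(3) by (simp add: strict_mono_less)
    qed
    show "surj \<tau>"
      unfolding surj_def
    proof
      fix s
      obtain t where "v s = H (u t)" using ran by blast
      then have "v s = v (\<tau> t)" by (simp add: v\<tau>)
      then show "\<exists>t. s = \<tau> t" using v(3) by (metis strict_mono_eq)
    qed
  qed (use v v\<tau> in auto)
qed

text \<open>
  Negative speed reduces to positive speed by reversing time.
\<close>

lemma solution_transport:
  assumes F: "bounded_lipschitz F" and G: "bounded_lipschitz G"
    and H: "sign_conjugacy H F G" and u: "solves F u"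
  shows "\<exists>v \<tau>. solves G v \<and> strict_mono \<tau> \<and> surj \<tau> \<and> (\<forall>t. H (u t) = v (\<tau> t))"
proof -
  consider "F (u 0) > 0" | "F (u 0) = 0" | "F (u 0) < 0" by linarith
  then show ?thesis
  proof cases
    case 1
    then show ?thesis using solution_transport_pos assms by blast
  next
    case 2
    obtain L where L: "\<And>x y. \<bar>F x - F y\<bar> \<le> L * \<bar>x - y\<bar>"
      using F unfolding bounded_lipschitz_def by blast
    have "u = (\<lambda>t. u 0)"
      by (rule solution_unique[OF u _ _ L]) (use 2 in \<open>auto simp: solves_def\<close>)
    then have const: "u t = u 0" for t by (rule fun_cong)
    have "G (H (u 0)) = 0" using H 2 by (metis sign_conjugacy_def sgn_zero_iff)
    then have "solves G (\<lambda>t. H (u 0))" by (simp add: solves_def)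
    then show ?thesis
      by (intro exI[of _ "\<lambda>t. H (u 0)"] exI[of _ "\<lambda>t. t"] conjI allI arg_cong[of _ _ H] const)
        (auto simp: strict_mono_def)
  next
    case 3
    have H': "sign_conjugacy H (\<lambda>x. - F x) (\<lambda>x. - G x)"
      using H by (simp add: sign_conjugacy_def sgn_minus)
    obtain v \<tau> where v: "solves (\<lambda>x. - G x) v" "strict_mono \<tau>" "surj \<tau>" "\<And>t. H (u (- t)) = v (\<tau> t)"
      using solution_transport_pos[OF bounded_lipschitz_uminus[OF F] bounded_lipschitz_uminus[OF G] H'
          solves_reverse[OF u]] 3 by auto
    show ?thesis
    proof (intro exI conjI allI)
      show "solves G (\<lambda>t. v (- t))" using solves_reverse[OF v(1)] by simp
      show "strict_mono (\<lambda>t. - \<tau> (- t))" using v(2) by (simp add: strict_mono_def)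
      show "surj (\<lambda>t. - \<tau> (- t))"
      proof (rule surjI)
        fix s
        have "\<tau> (- (- inv \<tau> (- s))) = - s" using v(3) by (simp add: surj_f_inv_f)
        then show "- \<tau> (- (- inv \<tau> (- s))) = s" by simp
      qed
      show "H (u t) = v (- (- \<tau> (- t)))" for t using v(4)[of "-t"] by simp
    qed
  qed
qed

lemma sign_conjugacy_inv:
  assumes "sign_conjugacy H F G" shows "sign_conjugacy (inv H) G F"
proof -
  have H: "strict_mono H" "surj H" "\<And>x. sgn (G (H x)) = sgn (F x)"
    using assms by (auto simp: sign_conjugacy_def)
  have inj: "inj H" using H(1) by (rule strict_mono_imp_inj_on)
  have "strict_mono (inv H)"
    using H by (metis strict_mono_inv_on_range)
  then show ?thesis
    using H inj unfolding sign_conjugacy_def by (metis inj_imp_surj_inv surj_f_inv_f)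
qed


section \<open>Functions and maps on the circle\<close>

text \<open>
  The topology of the circle is the quotient topology.
\<close>

lemma continuous_on_circle_iff:
  "continuous_on UNIV h \<longleftrightarrow> continuous_on UNIV (\<lambda>x. h (circle_of x))"
  for h :: "circle \<Rightarrow> 'a::topological_space"
  by (simp add: continuous_on_open_vimage open_circle_def vimage_def)

lemma continuous_circle_of: "continuous_on UNIV circle_of"
  by (simp add: continuous_on_open_vimage open_circle_def)

lemma periodic_add_of_int:
  fixes H :: "real \<Rightarrow> real"
  assumes "\<And>x. H (x + 1) = H x + 1"
  shows "H (x + of_int k) = H x + of_int k"
proof (induction k rule: int_induct[where k=0])
  case (step1 i)
  then show ?case using assms[of "x + of_int i"] by (simp add: add.assoc)
next
  case (step2 i)
  then show ?case using assms[of "x + of_int (i - 1)"] by (simp add: add.assoc)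
qed simp

text \<open>
  The independence of the representative that lets \<open>H\<close> descend to the circle.
\<close>

lemma circle_of_lift:
  assumes "\<And>x. H (x + 1) = H x + 1"
  shows "circle_of (H (rep_circle (circle_of x))) = circle_of (H x)"
proof -
  have "rep_circle (circle_of x) - x \<in> \<int>"
    by (simp flip: circle_of_eq_iff)
  then obtain k where "rep_circle (circle_of x) = x + of_int k"
    by (metis Ints_cases add.commute diff_add_cancel)
  then show ?thesis
    by (simp add: periodic_add_of_int[of H, OF assms] circle_of_eq_iff)
qed


lemma circle_of_add_Ints [simp]:
  "circle_of (x + of_int k) = circle_of x" "circle_of (x + 1) = circle_of x"
  by (simp_all add: circle_of_eq_iff)

lemma circle_cases: obtains x where "p = circle_of x" "0 \<le> x" "x < 1"
proof (rule that[of "frac (rep_circle p)"])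
  let ?y = "rep_circle p"
  have "circle_of (frac ?y) = circle_of ?y"
    unfolding circle_of_eq_iff by (simp add: frac_def)
  then show "p = circle_of (frac ?y)" unfolding circle_of_rep_circle by (rule sym)
qed (rule frac_ge_0 frac_lt_1)+

lemma compact_circle: "compact (UNIV :: circle set)"
proof -
  have "UNIV = circle_of ` {0..1}"
  proof
    show "UNIV \<subseteq> circle_of ` {0..1}"
    proof
      fix p show "p \<in> circle_of ` {0..1}"
        by (rule circle_cases[of p]) auto
    qed
  qed simp
  moreover have "compact (circle_of ` {0..1})"
    by (intro compact_continuous_image continuous_on_subset[OF continuous_circle_of]) auto
  ultimately show ?thesis by simp
qed

text \<open>
  All derivatives on the circle are computed on the line and transferred by this rule.
\<close>

lemma C1_circleI:
  assumes "\<And>x. ((\<lambda>x. f (circle_of x)) has_real_derivative D x) (at x)" and "continuous_on UNIV D"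
  shows "f \<in> C1_circle" and "circle_deriv f (circle_of x) = D x"
proof -
  show "f \<in> C1_circle"
    unfolding C1_circle_def C1_differentiable_on_def
    using assms by (auto simp: has_real_derivative_iff_has_vector_derivative)
  show "circle_deriv f (circle_of x) = D x"
    unfolding circle_deriv_circle_of by (rule DERIV_imp_deriv) (rule assms)
qed

lemma
  assumes "f \<in> C1_circle"
  shows C1_circle_deriv:
      "((\<lambda>x. f (circle_of x)) has_real_derivative circle_deriv f (circle_of x)) (at x)"
    and continuous_circle_deriv: "continuous_on UNIV (circle_deriv f)"
    and continuous_C1_circle: "continuous_on UNIV f"
proof -
  obtain D where D: "\<And>x. ((\<lambda>x. f (circle_of x)) has_real_derivative D x) (at x)" "continuous_on UNIV D"
    using assms
    by (auto simp: C1_circle_def C1_differentiable_on_def has_real_derivative_iff_has_vector_derivative)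
  note DD = C1_circleI(2)[OF D]
  show "((\<lambda>x. f (circle_of x)) has_real_derivative circle_deriv f (circle_of x)) (at x)" for x
    unfolding DD by (rule D)
  show "continuous_on UNIV (circle_deriv f)"
    unfolding continuous_on_circle_iff DD by (rule D)
  show "continuous_on UNIV f"
    unfolding continuous_on_circle_iff
    using D(1) by (meson DERIV_isCont continuous_at_imp_continuous_on)
qed

lemma bounded_continuous_circle:
  fixes \<phi> :: "circle \<Rightarrow> real"
  assumes "continuous_on UNIV \<phi>"
  obtains B where "\<And>p. \<bar>\<phi> p\<bar> \<le> B"
proof -
  have "bounded (range \<phi>)"
    by (intro compact_imp_bounded compact_continuous_image assms compact_circle)
  then show thesis using that by (auto simp: bounded_iff)
qed

lemma bounded_lipschitz_C1_circle:
  assumes "f \<in> C1_circle"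
  shows "bounded_lipschitz (\<lambda>x. f (circle_of x))"
proof -
  obtain B where B: "\<And>p. \<bar>f p\<bar> \<le> B"
    using bounded_continuous_circle[OF continuous_C1_circle[OF assms]] by blast
  obtain L where L: "\<And>p. \<bar>circle_deriv f p\<bar> \<le> L"
    using bounded_continuous_circle[OF continuous_circle_deriv[OF assms]] by blast
  have "\<bar>f (circle_of x) - f (circle_of y)\<bar> \<le> L * \<bar>x - y\<bar>" for x y
    using field_differentiable_bound[of UNIV "\<lambda>x. f (circle_of x)" "\<lambda>x. circle_deriv f (circle_of x)" L y x]
      C1_circle_deriv[OF assms] L by (simp add: abs_minus_commute)
  with B show ?thesis unfolding bounded_lipschitz_def by blast
qed

lemma C1_circle_diff:
  assumes "f \<in> C1_circle" "g \<in> C1_circle"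
  shows "(\<lambda>p. g p - f p) \<in> C1_circle"
    and "circle_deriv (\<lambda>p. g p - f p) = (\<lambda>p. circle_deriv g p - circle_deriv f p)"
proof -
  have D: "((\<lambda>x. g (circle_of x) - f (circle_of x)) has_real_derivative
      circle_deriv g (circle_of x) - circle_deriv f (circle_of x)) (at x)" for x
    by (intro derivative_intros C1_circle_deriv assms)
  have c: "continuous_on UNIV (\<lambda>x. circle_deriv g (circle_of x) - circle_deriv f (circle_of x))"
    using assms[THEN continuous_circle_deriv] by (auto simp: continuous_on_circle_iff intro!: continuous_intros)
  note * = C1_circleI[of "\<lambda>p. g p - f p", OF D c]
  show "(\<lambda>p. g p - f p) \<in> C1_circle" by (rule *)
  show "circle_deriv (\<lambda>p. g p - f p) = (\<lambda>p. circle_deriv g p - circle_deriv f p)"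
  proof
    fix p show "circle_deriv (\<lambda>p. g p - f p) p = circle_deriv g p - circle_deriv f p"
      using *(2)[of "rep_circle p"] by simp
  qed
qed

text \<open>
  The suprema in the norm dominate the pointwise values because both functions are bounded on the
  compact circle.
\<close>

lemma C1_ball_bounds:
  assumes f: "f \<in> C1_circle" and g: "g \<in> C1_ball \<epsilon> f"
  shows "\<bar>g p - f p\<bar> < \<epsilon>" "\<bar>circle_deriv g p - circle_deriv f p\<bar> < \<epsilon>"
proof -
  define d where "d p = g p - f p" for p
  have d: "d = (\<lambda>p. g p - f p)" by (simp add: d_def fun_eq_iff)
  have gC: "g \<in> C1_circle" and n: "C1_norm d < \<epsilon>"
    using g by (auto simp: C1_ball_def d)
  have dC: "d \<in> C1_circle" and d': "circle_deriv d = (\<lambda>p. circle_deriv g p - circle_deriv f p)"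
    using C1_circle_diff[OF f gC] by (auto simp: d)
  obtain B where B: "\<And>p. \<bar>d p\<bar> \<le> B"
    using bounded_continuous_circle[OF continuous_C1_circle[OF dC]] by blast
  obtain L where L: "\<And>p. \<bar>circle_deriv d p\<bar> \<le> L"
    using bounded_continuous_circle[OF continuous_circle_deriv[OF dC]] by blast
  have "\<bar>d p\<bar> \<le> (SUP p. \<bar>d p\<bar>)" for p
    using B by (intro cSUP_upper) (auto simp: bdd_above_def)
  moreover have "\<bar>circle_deriv d p\<bar> \<le> (SUP p. \<bar>circle_deriv d p\<bar>)" for p
    using L by (intro cSUP_upper) (auto simp: bdd_above_def)
  ultimately have "\<bar>d p\<bar> + \<bar>circle_deriv d q\<bar> < \<epsilon>" for p q
    using n unfolding C1_norm_def by (meson add_mono le_less_trans)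
  from this[of p p] have "\<bar>d p\<bar> < \<epsilon>" "\<bar>circle_deriv d p\<bar> < \<epsilon>" by linarith+
  then show "\<bar>g p - f p\<bar> < \<epsilon>" "\<bar>circle_deriv g p - circle_deriv f p\<bar> < \<epsilon>"
    unfolding d' d_def by auto
qed

lemma C1_ballI:
  assumes "f \<in> C1_circle" "g \<in> C1_circle"
    and "\<And>p. \<bar>g p - f p\<bar> \<le> a" "\<And>p. \<bar>circle_deriv g p - circle_deriv f p\<bar> \<le> b" "a + b < \<epsilon>"
  shows "g \<in> C1_ball \<epsilon> f"
proof -
  have "(SUP p. \<bar>g p - f p\<bar>) \<le> a" "(SUP p. \<bar>circle_deriv g p - circle_deriv f p\<bar>) \<le> b"
    using assms by (auto intro!: cSUP_least)
  then show ?thesis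
    using assms by (simp add: C1_ball_def C1_norm_def C1_circle_diff)
qed


section \<open>Topological equivalence from a sign-preserving map of the line\<close>

lemma continuous_sign_conjugacy:
  "sign_conjugacy H F G \<Longrightarrow> continuous_on UNIV H"
  by (intro continuous_onI_mono) (auto simp: sign_conjugacy_def strict_mono_less_eq)

text \<open>
  Both inclusions between the sets of orbits come from the transport of solutions, applied to \<open>H\<close> and
  to its inverse.
\<close>

lemma topologically_equivalent_if_sign_conjugacy:
  assumes F: "bounded_lipschitz (\<lambda>x. f (circle_of x))" and G: "bounded_lipschitz (\<lambda>x. g (circle_of x))"
    and H: "sign_conjugacy H (\<lambda>x. f (circle_of x)) (\<lambda>x. g (circle_of x))"
    and per: "\<And>x. H (x + 1) = H x + 1"
  shows "topologically_equivalent f g"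
proof -
  note H' = sign_conjugacy_inv[OF H]
  have surj: "surj H" and inj: "inj H"
    using H by (auto simp: sign_conjugacy_def intro: strict_mono_imp_inj_on)
  have per': "inv H (x + 1) = inv H x + 1" for x
    by (metis inj per surj inv_f_f surj_f_inv_f)
  define h where "h p = circle_of (H (rep_circle p))" for p
  define k where "k p = circle_of (inv H (rep_circle p))" for p
  have h: "h (circle_of x) = circle_of (H x)" for x
    unfolding h_def by (rule circle_of_lift) (rule per)
  have k: "k (circle_of x) = circle_of (inv H x)" for x
    unfolding k_def by (rule circle_of_lift) (rule per')
  have hk: "h (k p) = p" for p
    by (metis circle_of_rep_circle h k surj surj_f_inv_f)
  have kh: "k (h p) = p" for p
    by (metis circle_of_rep_circle h k inj inv_f_f)
  have "continuous_on UNIV h" "continuous_on UNIV k"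
    unfolding continuous_on_circle_iff h k
    using continuous_sign_conjugacy[OF H] continuous_sign_conjugacy[OF H']
    by (auto intro!: continuous_on_compose2[OF continuous_circle_of])
  then have "homeomorphic_map euclidean euclidean h"
    unfolding homeomorphic_map_maps homeomorphic_maps_def
    using hk kh by (intro exI[of _ k]) auto
  moreover have transport: "\<exists>\<delta> \<tau>. solution g' \<delta> \<and> strict_mono (\<tau>::real\<Rightarrow>real) \<and> surj \<tau> \<and> (\<forall>t. h' (\<gamma> t) = \<delta> (\<tau> t))"
    if *: "bounded_lipschitz (\<lambda>x. f' (circle_of x))" "bounded_lipschitz (\<lambda>x. g' (circle_of x))"
      "sign_conjugacy H' (\<lambda>x. f' (circle_of x)) (\<lambda>x. g' (circle_of x))"
      and h': "\<And>x. h' (circle_of x) = circle_of (H' x)" and \<gamma>: "solution f' \<gamma>" for f' g' h' H' \<gamma>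
  proof -
    obtain u where u: "solves (\<lambda>x. f' (circle_of x)) u" "\<And>t. \<gamma> t = circle_of (u t)"
      using \<gamma> by (auto simp: solution_def solves_def)
    obtain v \<tau> where v: "solves (\<lambda>x. g' (circle_of x)) v" "strict_mono \<tau>" "surj \<tau>" "\<And>t. H' (u t) = v (\<tau> t)"
      using solution_transport[OF * u(1)] by blast
    have "solution g' (\<lambda>t. circle_of (v t))"
      using v(1) by (auto simp: solution_def solves_def)
    then show ?thesis
      using v u(2) h' by (intro exI[of _ "\<lambda>t. circle_of (v t)"] exI[of _ \<tau>]) auto
  qed
  have range_transport: "h' ` A \<in> orbits g'"
    if *: "bounded_lipschitz (\<lambda>x. f' (circle_of x))" "bounded_lipschitz (\<lambda>x. g' (circle_of x))"
      "sign_conjugacy H' (\<lambda>x. f' (circle_of x)) (\<lambda>x. g' (circle_of x))"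
      and h': "\<And>x. h' (circle_of x) = circle_of (H' x)" and A: "A \<in> orbits f'" for f' g' h' H' A
  proof -
    obtain \<gamma> where \<gamma>: "solution f' \<gamma>" "A = range \<gamma>" using A by (auto simp: orbits_def)
    obtain \<delta> \<tau> where \<delta>: "solution g' \<delta>" "surj (\<tau>::real\<Rightarrow>real)" "\<And>t. h' (\<gamma> t) = \<delta> (\<tau> t)"
      using transport[OF * h' \<gamma>(1)] by blast
    have "h' ` A = range (\<lambda>t. \<delta> (\<tau> t))" unfolding \<gamma>(2) image_image \<delta>(3) ..
    also have "\<dots> = range \<delta>" using \<delta>(2) by (metis image_image)
    finally show ?thesis using \<delta>(1) by (auto simp: orbits_def)
  qed
  have "(\<lambda>A. h ` A) ` orbits f = orbits g"
  proof
    show "(\<lambda>A. h ` A) ` orbits f \<subseteq> orbits g"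
      using range_transport[OF F G H h] by blast
    show "orbits g \<subseteq> (\<lambda>A. h ` A) ` orbits f"
    proof
      fix A assume "A \<in> orbits g"
      then have "k ` A \<in> orbits f" by (rule range_transport[OF G F H' k])
      moreover have "A = h ` k ` A" by (simp add: image_image hk)
      ultimately show "A \<in> (\<lambda>A. h ` A) ` orbits f" by blast
    qed
  qed
  moreover have "preserves_time_orientation h f g"
    unfolding preserves_time_orientation_def using transport[OF F G H h] by blast
  ultimately show ?thesis unfolding topologically_equivalent_def by blast
qed

section \<open>Uniform estimates at hyperbolic zeros\<close>

text \<open>
  The number \<open>s\<close> only records the sign of the derivative: \<open>s * \<Phi>\<close> is strictly increasing on the
  interval.  The lemma also shows that \<open>q\<close> is the only zero there.
\<close>

lemma sgn_near_simple_zero: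
  fixes \<Phi> :: "real \<Rightarrow> real"
  assumes der: "\<And>x. a \<le> x \<Longrightarrow> x \<le> b \<Longrightarrow> (\<Phi> has_real_derivative \<Phi>' x) (at x)"
    and pos: "\<And>x. a \<le> x \<Longrightarrow> x \<le> b \<Longrightarrow> s * \<Phi>' x > 0"
    and q: "a \<le> q" "q \<le> b" "\<Phi> q = 0" and x: "a \<le> x" "x \<le> b"
  shows "sgn (\<Phi> x) = sgn s * sgn (x - q)"
proof -
  have mono: "s * \<Phi> y < s * \<Phi> z" if "a \<le> y" "y < z" "z \<le> b" for y z
    using \<open>y < z\<close>
  proof (rule DERIV_pos_imp_increasing)
    fix w assume "y \<le> w" "w \<le> z"
    then show "\<exists>d. ((\<lambda>x. s * \<Phi> x) has_real_derivative d) (at w) \<and> d > 0"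
      using that by (intro exI[of _ "s * \<Phi>' w"] conjI DERIV_cmult der pos) auto
  qed
  have "sgn (s * \<Phi> x) = sgn (x - q)"
    using mono[of x q] mono[of q x] q x by (cases x q rule: linorder_cases) auto
  moreover have "sgn s * sgn s = 1" using pos[OF x] by (auto simp: sgn_if)
  ultimately show ?thesis
    unfolding sgn_mult by (metis mult.assoc mult_1)
qed

text \<open>
  If no zero is degenerate, \<open>\<bar>f\<bar> + \<bar>f'\<bar>\<close> is positive, hence bounded below on the circle, and the
  uniform continuity of \<open>f'\<close> spreads the lower bound at the zeros to a common radius.  Two zeros within that
  radius would contradict the monotonicity between them.
\<close>

lemma hyperbolic_zeros_uniform:
  assumes f: "f \<in> C1_circle" and hyp: "\<forall>p\<in>fixed_points f. hyperbolic f p"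
  obtains \<delta> m :: real where "\<delta> > 0" "m > 0"
    "\<And>z x. f (circle_of z) = 0 \<Longrightarrow> \<bar>x - z\<bar> \<le> \<delta> \<Longrightarrow>
       sgn (circle_deriv f (circle_of z)) * circle_deriv f (circle_of x) \<ge> m"
    "\<And>z z'. f (circle_of z) = 0 \<Longrightarrow> f (circle_of z') = 0 \<Longrightarrow> z \<noteq> z' \<Longrightarrow> \<bar>z - z'\<bar> \<ge> 2 * \<delta>"
    "\<And>x. (\<And>z. f (circle_of z) = 0 \<Longrightarrow> \<bar>x - z\<bar> \<ge> \<delta>) \<Longrightarrow> \<bar>f (circle_of x)\<bar> \<ge> m"
proof -
  let ?F = "\<lambda>x. f (circle_of x)" and ?F' = "\<lambda>x. circle_deriv f (circle_of x)"
  have cF: "continuous_on UNIV ?F" and cF': "continuous_on UNIV ?F'"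
    using continuous_C1_circle[OF f] continuous_circle_deriv[OF f] by (auto simp: continuous_on_circle_iff)
  have "\<exists>p\<in>UNIV. \<forall>q\<in>UNIV. \<bar>f p\<bar> + \<bar>circle_deriv f p\<bar> \<le> \<bar>f q\<bar> + \<bar>circle_deriv f q\<bar>"
    by (intro continuous_attains_inf compact_circle continuous_intros continuous_C1_circle continuous_circle_deriv f) auto
  then obtain p where p: "\<And>q. \<bar>f p\<bar> + \<bar>circle_deriv f p\<bar> \<le> \<bar>f q\<bar> + \<bar>circle_deriv f q\<bar>" by blast
  define \<mu> where "\<mu> = \<bar>f p\<bar> + \<bar>circle_deriv f p\<bar>"
  have \<mu>: "\<mu> > 0"
    using hyp by (cases "f p = 0") (auto simp: \<mu>_def fixed_points_def hyperbolic_def)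
  have F'z: "\<bar>?F' z\<bar> \<ge> \<mu>" if "?F z = 0" for z
    using p[of "circle_of z"] that by (simp add: \<mu>_def)
  have "uniformly_continuous_on {-1..2} ?F'"
    by (intro compact_uniformly_continuous continuous_on_subset[OF cF']) auto
  then obtain \<eta> where \<eta>: "\<eta> > 0"
    "\<And>x y. x \<in> {-1..2} \<Longrightarrow> y \<in> {-1..2} \<Longrightarrow> \<bar>x - y\<bar> < \<eta> \<Longrightarrow> \<bar>?F' x - ?F' y\<bar> < \<mu> / 2"
    unfolding uniformly_continuous_on_def dist_real_def using \<mu> by (metis half_gt_zero)
  define \<delta>0 where "\<delta>0 = min (\<eta> / 2) 1"
  have \<delta>0: "\<delta>0 > 0" "\<delta>0 < \<eta>" "\<delta>0 \<le> 1" using \<eta>(1) by (auto simp: \<delta>0_def)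
  have F'_near: "\<bar>?F' x - ?F' z\<bar> < \<mu> / 2" if "\<bar>x - z\<bar> \<le> \<delta>0" for x z
  proof -
    let ?k = "of_int (- \<lfloor>z\<rfloor>) :: real"
    have "z + ?k \<in> {0..1}" by (simp, linarith)
    then have "\<bar>?F' (x + ?k) - ?F' (z + ?k)\<bar> < \<mu> / 2"
      by (intro \<eta>) (use that \<delta>0 in \<open>auto simp del: of_int_minus\<close>)
    then show ?thesis by (simp del: of_int_minus)
  qed
  have sF': "sgn (?F' z) * ?F' x \<ge> \<mu> / 2" if "?F z = 0" "\<bar>x - z\<bar> \<le> \<delta>0" for x z
  proof -
    have "?F' x - ?F' z < \<mu> / 2" "?F' z - ?F' x < \<mu> / 2"
      using F'_near[OF that(2)] by linarith+
    then show ?thesis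
      using F'z[OF that(1)] \<mu> by (cases "?F' z" "0 :: real" rule: linorder_cases) auto
  qed
  have sep: "\<bar>z - z'\<bar> \<ge> \<delta>0" if "?F z = 0" "?F z' = 0" "z \<noteq> z'" for z z'
  proof (rule ccontr)
    assume "\<not> ?thesis"
    then have d: "\<bar>z' - z\<bar> \<le> \<delta>0" by auto
    have "sgn (?F z') = sgn (sgn (?F' z)) * sgn (z' - z)"
      by (rule sgn_near_simple_zero[where a="z - \<delta>0" and b="z + \<delta>0" and \<Phi>="?F" and \<Phi>'="?F'"])
        (use that d \<delta>0 \<mu> in \<open>auto intro!: C1_circle_deriv[OF f] less_le_trans[OF _ sF'[OF that(1)]]\<close>)
    then show False using that F'z[OF that(1)] \<mu> by (auto simp: sgn_0_0)
  qed
  (* Half the radius, so that the closed \<delta>-neighbourhoods of different zeros do not overlap. *)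
  define \<delta> where "\<delta> = \<delta>0 / 2"
  (* Away from the zeros |F| has a positive lower bound by compactness of one period. *)
  define C where "C = {x\<in>{0..1}. \<forall>z\<in>{z. ?F z = 0}. \<delta> \<le> \<bar>x - z\<bar>}"
  have "C = {0..1} \<inter> (\<Inter>z\<in>{z. ?F z = 0}. {x. \<delta> \<le> \<bar>x - z\<bar>})"
    by (auto simp: C_def)
  moreover have "closed \<dots>"
    by (intro closed_Int closed_INT ballI closed_Collect_le continuous_intros closed_atLeastAtMost)
  ultimately have "closed C" by simp
  then have "compact C"
    unfolding compact_eq_bounded_closed by (auto simp: C_def intro: bounded_subset[of "{0..1}"])
  obtain m0 where m0: "m0 > 0" "\<And>x. x \<in> C \<Longrightarrow> \<bar>?F x\<bar> \<ge> m0"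
  proof (cases "C = {}")
    case False
    have "\<exists>x\<in>C. \<forall>y\<in>C. \<bar>?F x\<bar> \<le> \<bar>?F y\<bar>"
      by (intro continuous_attains_inf \<open>compact C\<close> False continuous_intros continuous_on_subset[OF cF]) auto
    then obtain x where x: "x \<in> C" "\<And>y. y \<in> C \<Longrightarrow> \<bar>?F x\<bar> \<le> \<bar>?F y\<bar>" by blast
    have "?F x \<noteq> 0" using x(1) \<delta>0 by (auto simp: C_def \<delta>_def)
    then show thesis using x(2) by (intro that[of "\<bar>?F x\<bar>"]) auto
  qed (use that[of 1] in auto)
  show thesis
  proof (rule that[of \<delta> "min m0 (\<mu> / 2)"])
    fix x assume x: "\<And>z. ?F z = 0 \<Longrightarrow> \<bar>x - z\<bar> \<ge> \<delta>"
    let ?k = "of_int (- \<lfloor>x\<rfloor>) :: real"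
    have "x + ?k \<in> C"
      unfolding C_def
    proof (intro CollectI conjI ballI)
      show "x + ?k \<in> {0..1}" by (simp, linarith)
      fix z assume "z \<in> {z. ?F z = 0}"
      then have "?F (z + of_int \<lfloor>x\<rfloor>) = 0" by simp
      from x[OF this] show "\<delta> \<le> \<bar>x + ?k - z\<bar>" by (simp add: algebra_simps)
    qed
    from m0(2)[OF this] show "min m0 (\<mu> / 2) \<le> \<bar>?F x\<bar>" by (simp del: of_int_minus)
  next
    fix z x assume "?F z = 0" "\<bar>x - z\<bar> \<le> \<delta>"
    then show "sgn (?F' z) * ?F' x \<ge> min m0 (\<mu> / 2)"
      using sF'[of z x] \<delta>0 by (auto simp: \<delta>_def)
  qed (use \<delta>0 \<mu> m0 sep in \<open>auto simp: \<delta>_def\<close>)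
qed

text \<open>
  Zeros in the unit interval are at least \<open>2 * \<delta>\<close> apart, so each cell of length \<open>\<delta>\<close> contains at most one.
\<close>

lemma finite_hyperbolic_fixed_points:
  assumes f: "f \<in> C1_circle" and hyp: "\<forall>p\<in>fixed_points f. hyperbolic f p"
  shows "finite (fixed_points f)"
proof -
  obtain \<delta> :: real where \<delta>: "\<delta> > 0"
    and sep: "\<And>z z'. f (circle_of z) = 0 \<Longrightarrow> f (circle_of z') = 0 \<Longrightarrow> z \<noteq> z' \<Longrightarrow> \<bar>z - z'\<bar> \<ge> 2 * \<delta>"
    using hyperbolic_zeros_uniform[OF assms] by metis
  define Z where "Z = {z\<in>{0..1}. f (circle_of z) = 0}"
  have "inj_on (\<lambda>z. \<lfloor>z / \<delta>\<rfloor>) Z"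
  proof (rule inj_onI, rule ccontr)
    fix y z assume yz: "y \<in> Z" "z \<in> Z" "\<lfloor>y / \<delta>\<rfloor> = \<lfloor>z / \<delta>\<rfloor>" "y \<noteq> z"
    then have "\<bar>y / \<delta> - z / \<delta>\<bar> < 1" by linarith
    then have "\<bar>y - z\<bar> < \<delta>" using \<delta> by (simp add: diff_divide_distrib[symmetric] abs_divide)
    with sep[of y z] yz \<delta> show False by (auto simp: Z_def)
  qed
  moreover have "(\<lambda>z. \<lfloor>z / \<delta>\<rfloor>) ` Z \<subseteq> {0..\<lfloor>1 / \<delta>\<rfloor>}"
    using \<delta> by (auto simp: Z_def intro!: floor_mono divide_right_mono)
  ultimately have "finite Z" by (meson finite_atLeastAtMost_int finite_imageD finite_subset)
  moreover have "fixed_points f \<subseteq> circle_of ` Z"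
  proof
    fix p assume "p \<in> fixed_points f"
    moreover obtain x where "p = circle_of x" "0 \<le> x" "x < 1" by (rule circle_cases)
    ultimately show "p \<in> circle_of ` Z" by (auto simp: fixed_points_def Z_def)
  qed
  ultimately show ?thesis by (meson finite_imageI finite_subset)
qed

section \<open>Hyperbolic fixed points give structural stability\<close>

text \<open>
  Near \<open>z \<in> Z\<close> the point \<open>x\<close> is displaced by the tent function of height \<open>r z * \<delta>\<close> supported on
  \<open>\<bar>x - z\<bar> \<le> \<delta>\<close>; the other points stay put.  The slopes of the tent are \<open>\<plusminus> r z\<close>, so the map is
  increasing when \<open>\<bar>r z\<bar> < 1\<close>, and it takes \<open>z\<close> to \<open>z + r z * \<delta>\<close>, which can be any point closer to \<open>z\<close>
  than \<open>\<delta>\<close>.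
\<close>

definition tent_displacement :: "real set \<Rightarrow> real \<Rightarrow> (real \<Rightarrow> real) \<Rightarrow> real \<Rightarrow> real" where
  "tent_displacement Z \<delta> r x =
     (if \<exists>z\<in>Z. \<bar>x - z\<bar> < \<delta>
      then let z = (THE z. z \<in> Z \<and> \<bar>x - z\<bar> < \<delta>) in x + r z * (\<delta> - \<bar>x - z\<bar>)
      else x)"

locale tent =
  fixes Z :: "real set" and \<delta> :: real and r :: "real \<Rightarrow> real"
  assumes \<delta>: "\<delta> > 0"
    and sep: "\<And>z z'. z \<in> Z \<Longrightarrow> z' \<in> Z \<Longrightarrow> z \<noteq> z' \<Longrightarrow> \<bar>z - z'\<bar> \<ge> 2 * \<delta>"
    and r: "\<And>z. z \<in> Z \<Longrightarrow> \<bar>r z\<bar> < 1"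
begin

abbreviation "H \<equiv> tent_displacement Z \<delta> r"

lemma H_near: "H x = x + r z * (\<delta> - \<bar>x - z\<bar>)" if z: "z \<in> Z" "\<bar>x - z\<bar> < \<delta>"
proof -
  have "(THE z. z \<in> Z \<and> \<bar>x - z\<bar> < \<delta>) = z"
  proof (rule the_equality)
    fix z' assume z': "z' \<in> Z \<and> \<bar>x - z'\<bar> < \<delta>"
    show "z' = z"
    proof (rule ccontr)
      assume "z' \<noteq> z"
      then have "\<bar>z' - z\<bar> \<ge> 2 * \<delta>" using sep z z' by blast
      then show False using z z' by linarith
    qed
  qed (use z in auto)
  then show ?thesis using z unfolding tent_displacement_def by auto
qed

lemma H_far: "H x = x" if "\<And>z. z \<in> Z \<Longrightarrow> \<bar>x - z\<bar> \<ge> \<delta>"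
  using that unfolding tent_displacement_def by force

text \<open>
  The displacement is a Lipschitz function with constant \<open>\<bar>r z\<bar> < 1\<close>.
\<close>

lemma local_mono:
  assumes "z \<in> Z" "x < y"
  shows "x + r z * (\<delta> - \<bar>x - z\<bar>) < y + r z * (\<delta> - \<bar>y - z\<bar>)"
proof -
  have "\<bar>r z * (\<bar>y - z\<bar> - \<bar>x - z\<bar>)\<bar> \<le> \<bar>r z\<bar> * \<bar>y - x\<bar>"
    unfolding abs_mult by (intro mult_left_mono) auto
  also have "\<dots> < 1 * \<bar>y - x\<bar>"
    using r[OF assms(1)] assms(2) by (intro mult_strict_right_mono) auto
  finally show ?thesis using assms(2) by (simp add: algebra_simps abs_less_iff)
qed

text \<open>
  Monotonicity and the fixed end points of the tent keep each interval invariant; this reduces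
  global monotonicity and surjectivity to a single interval.
\<close>

lemma H_stays: "\<bar>H x - z\<bar> < \<delta>" if z: "z \<in> Z" "\<bar>x - z\<bar> < \<delta>"
  using local_mono[OF z(1), of "z - \<delta>" x] local_mono[OF z(1), of x "z + \<delta>"] \<delta> z
  unfolding H_near[OF z] by (simp add: abs_less_iff)

lemma strict_mono_H: "strict_mono H"
proof (rule strict_monoI)
  fix x y :: real assume "x < y"
  show "H x < H y"
  proof (cases "\<exists>z\<in>Z. \<bar>x - z\<bar> < \<delta>")
    case True
    then obtain z where z: "z \<in> Z" "\<bar>x - z\<bar> < \<delta>" by blast
    show ?thesis
    proof (cases "\<exists>w\<in>Z. \<bar>y - w\<bar> < \<delta>")
      case True
      then obtain w where w: "w \<in> Z" "\<bar>y - w\<bar> < \<delta>" by blast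
      show ?thesis
      proof (cases "w = z")
        case True
        then show ?thesis
          using H_near[OF z] H_near[OF w] local_mono[OF z(1) \<open>x < y\<close>] by simp
      next
        case False
        then show ?thesis
          using H_stays[OF z] H_stays[OF w] sep[OF w(1) z(1)] \<open>x < y\<close> z w by linarith
      qed
    next
      case False
      then have "H y = y" "\<bar>y - z\<bar> \<ge> \<delta>" using H_far z by force+
      then show ?thesis using H_stays[OF z] \<open>x < y\<close> z by linarith
    qed
  next
    case False
    then have x: "H x = x" "\<And>w. w \<in> Z \<Longrightarrow> \<bar>x - w\<bar> \<ge> \<delta>" using H_far by force+
    show ?thesis
    proof (cases "\<exists>w\<in>Z. \<bar>y - w\<bar> < \<delta>")
      case True
      then obtain w where w: "w \<in> Z" "\<bar>y - w\<bar> < \<delta>" by blast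
      then show ?thesis using H_stays[OF w] x(1) x(2)[OF w(1)] \<open>x < y\<close> by linarith
    next
      case False
      then have "H y = y" using H_far by force
      then show ?thesis using x(1) \<open>x < y\<close> by simp
    qed
  qed
qed

lemma surj_H: "surj H"
  unfolding surj_def
proof
  fix y
  show "\<exists>x. y = H x"
  proof (cases "\<exists>z\<in>Z. \<bar>y - z\<bar> < \<delta>")
    case True
    then obtain z where z: "z \<in> Z" "\<bar>y - z\<bar> < \<delta>" by blast
    have "\<exists>x\<ge>z - \<delta>. x \<le> z + \<delta> \<and> x + r z * (\<delta> - \<bar>x - z\<bar>) = y"
    proof (rule IVT')
      show "continuous_on {z - \<delta>..z + \<delta>} (\<lambda>x. x + r z * (\<delta> - \<bar>x - z\<bar>))"
        by (intro continuous_intros)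
    qed (use \<delta> z in auto)
    then obtain x where x: "z - \<delta> \<le> x" "x \<le> z + \<delta>" "x + r z * (\<delta> - \<bar>x - z\<bar>) = y" by blast
    have "x \<noteq> z - \<delta>" "x \<noteq> z + \<delta>" using x(3) z \<delta> by auto
    then have "\<bar>x - z\<bar> < \<delta>" using x by (simp add: abs_less_iff)
    then show ?thesis using H_near[OF z(1)] x(3) by metis
  next
    case False
    then show ?thesis using H_far[of y] by (metis not_le)
  qed
qed

lemma H_periodic:
  assumes Z: "\<And>z. z + 1 \<in> Z \<longleftrightarrow> z \<in> Z" and r1: "\<And>z. z \<in> Z \<Longrightarrow> r (z + 1) = r z"
  shows "H (x + 1) = H x + 1"
proof (cases "\<exists>z\<in>Z. \<bar>x - z\<bar> < \<delta>")
  case True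
  then obtain z where z: "z \<in> Z" "\<bar>x - z\<bar> < \<delta>" by blast
  then have "H (x + 1) = x + 1 + r (z + 1) * (\<delta> - \<bar>x + 1 - (z + 1)\<bar>)"
    using Z by (intro H_near) auto
  then show ?thesis using H_near[OF z] r1 z by simp
next
  case False
  have "\<bar>x + 1 - w\<bar> \<ge> \<delta>" if "w \<in> Z" for w
  proof -
    have "w - 1 \<in> Z" using Z[of "w - 1"] that by simp
    with False show ?thesis by (force simp: algebra_simps)
  qed
  then have "H (x + 1) = x + 1" by (rule H_far)
  moreover have "H x = x" using False H_far by force
  ultimately show ?thesis by simp
qed

end

text \<open>
  The radius of the stable ball is the constant \<open>m\<close> of \<open>hyperbolic_zeros_uniform\<close>: a smaller
  change can neither reverse \<open>F'\<close> near the zeros nor the sign of \<open>F\<close> away from them.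
\<close>

lemma hyperbolic_imp_stable:
  assumes f: "f \<in> C1_circle" and hyp: "\<forall>p\<in>fixed_points f. hyperbolic f p"
  shows "C1_structurally_stable f"
proof -
  obtain \<delta> m :: real where \<delta>: "\<delta> > 0" and m: "m > 0"
    and near: "\<And>z x. f (circle_of z) = 0 \<Longrightarrow> \<bar>x - z\<bar> \<le> \<delta> \<Longrightarrow>
       sgn (circle_deriv f (circle_of z)) * circle_deriv f (circle_of x) \<ge> m"
    and sep: "\<And>z z'. f (circle_of z) = 0 \<Longrightarrow> f (circle_of z') = 0 \<Longrightarrow> z \<noteq> z' \<Longrightarrow> \<bar>z - z'\<bar> \<ge> 2 * \<delta>"
    and far: "\<And>x. (\<And>z. f (circle_of z) = 0 \<Longrightarrow> \<bar>x - z\<bar> \<ge> \<delta>) \<Longrightarrow> \<bar>f (circle_of x)\<bar> \<ge> m"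
    using hyperbolic_zeros_uniform[OF assms] by metis
  have equiv: "topologically_equivalent f g" if g: "g \<in> C1_ball m f" for g
  proof -
    have gC: "g \<in> C1_circle" using g by (simp add: C1_ball_def)
    note close = C1_ball_bounds[OF f g]
    let ?F = "\<lambda>x. f (circle_of x)" and ?F' = "\<lambda>x. circle_deriv f (circle_of x)"
    let ?G = "\<lambda>x. g (circle_of x)" and ?G' = "\<lambda>x. circle_deriv g (circle_of x)"
    define Z where "Z = {z. ?F z = 0}"
    have F'0: "?F' z \<noteq> 0" if "z \<in> Z" for z
      using near[of z z] that \<delta> m by (auto simp: Z_def)
    have Gnear: "sgn (?F' z) * ?G' x > 0" if "z \<in> Z" "\<bar>x - z\<bar> \<le> \<delta>" for z x
    proof -
      have "m \<le> sgn (?F' z) * ?F' x" using near that by (simp add: Z_def)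
      moreover have "\<bar>sgn (?F' z) * (?G' x - ?F' x)\<bar> < m"
        using close(2)[of "circle_of x"] F'0[OF that(1)] by (simp add: abs_mult abs_sgn_eq)
      ultimately show ?thesis by (simp add: right_diff_distrib abs_less_iff)
    qed
    have far_sgn: "sgn (?G x) = sgn (?F x)" if "\<And>z. z \<in> Z \<Longrightarrow> \<bar>x - z\<bar> \<ge> \<delta>" for x
    proof -
      have "\<bar>?F x\<bar> \<ge> m" using far that by (simp add: Z_def)
      then show ?thesis using close(1)[of "circle_of x"] by (auto simp: sgn_if abs_if split: if_splits)
    qed
    have Fsgn: "sgn (?F x) = sgn (?F' z) * sgn (x - z)" if z: "z \<in> Z" and x: "\<bar>x - z\<bar> \<le> \<delta>" for z x
    proof -
      have "sgn (?F x) = sgn (sgn (?F' z)) * sgn (x - z)"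
        by (rule sgn_near_simple_zero[where a="z - \<delta>" and b="z + \<delta>" and \<Phi>'="?F'"])
          (use z x \<delta> m near in \<open>auto simp: Z_def abs_le_iff intro!: C1_circle_deriv[OF f] less_le_trans[OF m near]\<close>)
      then show ?thesis by simp
    qed
    have Gsgn: "sgn (?G x) = sgn (?F' z) * sgn (x - q)"
      if z: "z \<in> Z" and x: "\<bar>x - z\<bar> \<le> \<delta>" and q: "\<bar>q - z\<bar> < \<delta>" "?G q = 0" for z x q
    proof -
      have "sgn (?G x) = sgn (sgn (?F' z)) * sgn (x - q)"
        by (rule sgn_near_simple_zero[where a="z - \<delta>" and b="z + \<delta>" and \<Phi>'="?G'"])
          (use x q in \<open>auto simp: abs_le_iff abs_less_iff intro!: C1_circle_deriv[OF gC] Gnear z\<close>)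
      then show ?thesis by simp
    qed
    have q_ex: "\<exists>q. \<bar>q - z\<bar> < \<delta> \<and> ?G q = 0" if z: "z \<in> Z" for z
    proof -
      (* The ends z - \<delta> and z + \<delta> are far from all zeros of F, so G has the sign of F there. *)
      have dist_ends: "\<bar>x - w\<bar> \<ge> \<delta>" if "\<bar>x - z\<bar> = \<delta>" "w \<in> Z" for x w
        using sep[of w z] that z by (cases "w = z") (auto simp: Z_def)
      have ends: "sgn (?G (z + \<delta>)) = sgn (?F' z)" "sgn (?G (z - \<delta>)) = - sgn (?F' z)"
        using far_sgn[of "z + \<delta>"] far_sgn[of "z - \<delta>"] dist_ends Fsgn[OF z, of "z + \<delta>"] Fsgn[OF z, of "z - \<delta>"] \<delta>
        by auto
      have "sgn (?F' z) * ?G (z + \<delta>) = \<bar>?G (z + \<delta>)\<bar>" "sgn (?F' z) * ?G (z - \<delta>) = - \<bar>?G (z - \<delta>)\<bar>"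
        using ends by (metis abs_sgn mult.commute, metis abs_sgn mult.commute mult_minus_right minus_minus)
      then have "\<exists>q\<ge>z - \<delta>. q \<le> z + \<delta> \<and> sgn (?F' z) * ?G q = 0"
        using \<delta> continuous_C1_circle[OF gC]
        by (intro IVT') (auto simp: continuous_on_circle_iff intro!: continuous_intros intro: continuous_on_subset)
      then obtain q where q: "z - \<delta> \<le> q" "q \<le> z + \<delta>" "?G q = 0"
        using F'0[OF z] by (auto simp: sgn_0_0)
      moreover have "q \<noteq> z - \<delta>" "q \<noteq> z + \<delta>"
        using ends q(3) F'0[OF z] by (auto simp: sgn_0_0)
      ultimately show ?thesis by (intro exI[of _ q]) (auto simp: abs_less_iff)
    qed
    define q where "q z = (SOME q. \<bar>q - z\<bar> < \<delta> \<and> ?G q = 0)" for z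
    have q: "\<bar>q z - z\<bar> < \<delta>" "?G (q z) = 0" if "z \<in> Z" for z
      using someI_ex[OF q_ex[OF that]] by (auto simp: q_def)
    have q_unique: "q' = q z" if "z \<in> Z" "\<bar>q' - z\<bar> < \<delta>" "?G q' = 0" for z q'
      using Gsgn[OF that(1) _ q[OF that(1)], of q'] that F'0[OF that(1)] by (auto simp: sgn_0_0)
    (* With this height the tent map takes z exactly to q z. *)
    define r where "r z = (q z - z) / \<delta>" for z
    interpret tent Z \<delta> r
      by unfold_locales (use \<delta> sep q in \<open>auto simp: Z_def r_def abs_divide\<close>)
    have Hz: "H z = q z" if "z \<in> Z" for z
      using H_near[OF that, of z] \<delta> by (simp add: r_def)
    have "sgn (?G (H x)) = sgn (?F x)" for x
    proof (cases "\<exists>z\<in>Z. \<bar>x - z\<bar> < \<delta>")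
      case True
      then obtain z where z: "z \<in> Z" "\<bar>x - z\<bar> < \<delta>" by blast
      have "sgn (?G (H x)) = sgn (?F' z) * sgn (H x - q z)"
        using z H_stays[OF z] q by (intro Gsgn) auto
      also have "sgn (H x - q z) = sgn (x - z)"
        unfolding Hz[OF z(1), symmetric]
        using strict_mono_less[OF strict_mono_H, of x z] strict_mono_less[OF strict_mono_H, of z x]
        by (cases x z rule: linorder_cases) auto
      also have "sgn (?F' z) * sgn (x - z) = sgn (?F x)"
        using Fsgn z by simp
      finally show ?thesis .
    next
      case False
      then have "H x = x" using H_far by force
      then show ?thesis using far_sgn False by force
    qed
    then have conj: "sign_conjugacy H ?F ?G"
      using strict_mono_H surj_H by (simp add: sign_conjugacy_def)
    have Z1: "z + 1 \<in> Z \<longleftrightarrow> z \<in> Z" for z by (simp add: Z_def)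
    have r1: "r (z + 1) = r z" if "z \<in> Z" for z
    proof -
      have "q z + 1 = q (z + 1)"
        using q[OF that] Z1 that by (intro q_unique) auto
      then show ?thesis by (simp add: r_def)
    qed
    show ?thesis
      by (rule topologically_equivalent_if_sign_conjugacy[OF _ _ conj H_periodic])
        (use Z1 r1 in \<open>auto intro: bounded_lipschitz_C1_circle f gC\<close>)
  qed
  have mono: "C1_ball \<epsilon> f \<subseteq> C1_ball m f" if "\<epsilon> < m" for \<epsilon>
    using that by (auto simp: C1_ball_def)
  show ?thesis
    unfolding C1_structurally_stable_def eventually_at_right_field
    using equiv mono m by (meson subsetD)
qed

section \<open>Structural stability forces hyperbolic fixed points\<close>

text \<open>
  On a one-point orbit the lifted solution moves with constant speed \<open>f p\<close> inside a coset of the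
  integers, so the speed is zero.
\<close>

lemma singleton_orbit_iff: "{p} \<in> orbits f \<longleftrightarrow> p \<in> fixed_points f"
proof
  assume "{p} \<in> orbits f"
  then obtain u where u: "\<And>t. (u has_real_derivative f (circle_of (u t))) (at t)"
    and p: "\<And>t. circle_of (u t) = p"
    unfolding orbits_def solution_def by (smt (verit) mem_Collect_eq rangeI singletonD)
  have lin: "u t - f p * t = u 0 - f p * 0" for t
  proof (rule DERIV_isconst_all[where f="\<lambda>t. u t - f p * t", rule_format])
    fix t show "((\<lambda>t. u t - f p * t) has_real_derivative 0) (at t)"
      using u[of t] by (auto intro!: derivative_eq_intros simp: p)
  qed
  show "p \<in> fixed_points f"
  proof (rule ccontr)
    assume "p \<notin> fixed_points f"
    then have "f p \<noteq> 0" by (simp add: fixed_points_def)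
    with lin[of "1 / (2 * f p)"] have "u (1 / (2 * f p)) - u 0 = 1 / 2" by simp
    moreover have "u (1 / (2 * f p)) - u 0 \<in> \<int>"
      unfolding circle_of_eq_iff[symmetric] p ..
    ultimately obtain k where "1 / 2 = real_of_int k" by (metis Ints_cases)
    then have "real_of_int (2 * k) = real_of_int 1" by simp
    then show False unfolding of_int_eq_iff by presburger
  qed
next
  assume "p \<in> fixed_points f"
  then have "solution f (\<lambda>t. p)"
    unfolding solution_def fixed_points_def by (intro exI[of _ "\<lambda>t. rep_circle p"]) auto
  then show "{p} \<in> orbits f"
    unfolding orbits_def by (intro CollectI exI[of _ "\<lambda>t. p"]) auto
qed

lemma finite_fixed_points_equivalent:
  assumes "topologically_equivalent f g"
  shows "finite (fixed_points f) \<longleftrightarrow> finite (fixed_points g)"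
proof -
  obtain h where h: "homeomorphic_map euclidean euclidean h" and orb: "(\<lambda>A. h ` A) ` orbits f = orbits g"
    using assms by (auto simp: topologically_equivalent_def)
  have inj: "inj h" using homeomorphic_imp_injective_map[OF h] by simp
  have "fixed_points g = h ` fixed_points f"
  proof
    show "h ` fixed_points f \<subseteq> fixed_points g"
    proof
      fix q assume "q \<in> h ` fixed_points f"
      then obtain p where p: "q = h p" "{p} \<in> orbits f" by (auto simp: singleton_orbit_iff)
      then have "h ` {p} \<in> orbits g" using orb by blast
      then show "q \<in> fixed_points g" using p by (simp add: singleton_orbit_iff)
    qed
    show "fixed_points g \<subseteq> h ` fixed_points f"
    proof
      fix q assume "q \<in> fixed_points g"
      then have "{q} \<in> orbits g" by (simp add: singleton_orbit_iff)
      then obtain A where A: "A \<in> orbits f" "h ` A = {q}" using orb by (metis imageE)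
      then obtain p where p: "p \<in> A" "h p = q" by blast
      have "A = {p}" using A(2) p inj by (auto simp: inj_def)
      then show "q \<in> h ` fixed_points f" using A(1) p by (auto simp: singleton_orbit_iff)
    qed
  qed
  then show ?thesis using inj by (simp add: finite_image_iff inj_on_subset)
qed

text \<open>
  Sard's theorem on the line.  It is applied to functions on \<open>real^1\<close>, since it is stated for
  Cartesian powers: the critical values are negligible, so they cannot fill an interval.
\<close>

lemma regular_value_exists:
  fixes F :: "real \<Rightarrow> real"
  assumes der: "\<And>x. (F has_real_derivative F' x) (at x)" and "a < b"
  shows "\<exists>c. a < c \<and> c < b \<and> (\<forall>x. F x = c \<longrightarrow> F' x \<noteq> 0)"
proof (rule ccontr)
  assume "\<not> ?thesis"
  then have crit: "\<exists>x. F x = c \<and> F' x = 0" if "a < c" "c < b" for c using that by blast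
  define S where "S = {v :: real^1. F' (v $ 1) = 0}"
  define \<phi> :: "real^1 \<Rightarrow> real^1" where "\<phi> v = (\<chi> i. F (v $ 1))" for v
  have "negligible (\<phi> ` S)"
  proof (rule baby_Sard[where f'="\<lambda>v h. 0"])
    fix v assume v: "v \<in> S"
    have F: "(F has_derivative (\<lambda>h. 0)) (at (v $ 1))"
      using der[of "v $ 1"] v by (simp add: has_field_derivative_def S_def lambda_zero)
    have "((\<lambda>v. F (v $ 1)) has_derivative (\<lambda>h. 0)) (at v)"
      using has_derivative_compose[OF bounded_linear_imp_has_derivative[OF bounded_linear_vec_nth] F] .
    then have "((\<lambda>v. F (v $ 1)) has_derivative (\<lambda>h. 0)) (at v within S)"
      by (rule has_derivative_at_withinI)
    then show "(\<phi> has_derivative (\<lambda>h. 0)) (at v within S)"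
      unfolding \<phi>_def has_derivative_componentwise_within[of "\<lambda>v. \<chi> i. F (v $ 1)"]
      by (auto simp: Basis_vec_def inner_axis)
    show "rank (matrix (\<lambda>h::real^1. 0 :: real^1)) < CARD(1)"
      by (simp add: matrix_def rank_eq_0 vec_eq_iff zero_vec_def)
  qed simp
  moreover have "box (\<chi> i. a) (\<chi> i. b) \<subseteq> \<phi> ` S"
  proof
    fix c :: "real^1" assume "c \<in> box (\<chi> i. a) (\<chi> i. b)"
    then have "a < c $ 1" "c $ 1 < b" by (auto simp: mem_box_cart)
    then obtain x where x: "F x = c $ 1" "F' x = 0" using crit by blast
    have "c = \<phi> (\<chi> i. x)" using x by (simp add: \<phi>_def vec_eq_iff forall_1)
    moreover have "(\<chi> i. x) \<in> S" using x by (simp add: S_def)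
    ultimately show "c \<in> \<phi> ` S" by blast
  qed
  ultimately have "negligible (box (\<chi> i. a) (\<chi> i. b) :: (real^1) set)"
    by (rule negligible_subset)
  then have "box (\<chi> i. a) (\<chi> i. b) = ({} :: (real^1) set)" by (simp add: negligible_interval)
  moreover have "(\<chi> i. (a + b) / 2) \<in> (box (\<chi> i. a) (\<chi> i. b) :: (real^1) set)"
    using \<open>a < b\<close> by (simp add: mem_box_cart)
  ultimately show False by blast
qed

text \<open>
  A \<open>C\<^sup>1\<close> function that vanishes on the negative half-line and is at least 1 from 1 on; composing two of them
  gives a \<open>C\<^sup>1\<close> transition from 0 to 1 without gluing.
\<close>

definition ramp :: "real \<Rightarrow> real" where
  "ramp t = (max 0 t)\<^sup>2"

lemma DERIV_ramp: "(ramp has_real_derivative 2 * max 0 t) (at t)"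
proof (cases t "0 :: real" rule: linorder_cases)
  case less
  have "((\<lambda>t. 0) has_real_derivative 2 * max 0 t) (at t)" using less by simp
  then show ?thesis
    by (rule has_field_derivative_transform_within_open[of _ _ _ "{..<0}"]) (use less in \<open>auto simp: ramp_def\<close>)
next
  case greater
  have "((\<lambda>t. t\<^sup>2) has_real_derivative 2 * max 0 t) (at t)"
    using greater by (auto intro!: derivative_eq_intros)
  then show ?thesis
    by (rule has_field_derivative_transform_within_open[of _ _ _ "{0<..}"]) (use greater in \<open>auto simp: ramp_def\<close>)
next
  case equal
  have "((\<lambda>h. (ramp (0 + h) - ramp 0) / h) \<longlongrightarrow> 0) (at 0)"
  proof (rule Lim_null_comparison[where g=abs])
    show "\<forall>\<^sub>F h in at 0. norm ((ramp (0 + h) - ramp 0) / h) \<le> \<bar>h\<bar>"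
      by (auto simp: ramp_def max_def power2_eq_square eventually_at_filter)
    show "(abs \<longlongrightarrow> (0::real)) (at 0)" by (rule tendsto_eq_intros | simp)+
  qed
  then show ?thesis unfolding DERIV_def equal by simp
qed

definition cutoff :: "real \<Rightarrow> real" where
  "cutoff t = 1 - ramp (1 - ramp t)"

lemma ramp_simps [simp]: "t \<le> 0 \<Longrightarrow> ramp t = 0" "0 \<le> ramp t"
  by (simp_all add: ramp_def max_def)

lemma ramp_ge_1: "t \<ge> 1 \<Longrightarrow> ramp t \<ge> 1"
  by (simp add: ramp_def max_def one_le_power)

lemma cutoff_eq: "t \<le> 0 \<Longrightarrow> cutoff t = 0" "t \<ge> 1 \<Longrightarrow> cutoff t = 1"
  using ramp_ge_1[of t] by (simp_all add: cutoff_def) (simp add: ramp_def)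

lemma cutoff_bounds: "\<bar>cutoff t - 1\<bar> \<le> 1"
  by (simp add: cutoff_def ramp_def power_le_one)

definition cutoff_deriv :: "real \<Rightarrow> real" where
  "cutoff_deriv t = 4 * max 0 (1 - ramp t) * max 0 t"

lemma DERIV_cutoff: "(cutoff has_real_derivative cutoff_deriv t) (at t)"
proof -
  have "((\<lambda>t. 1 - ramp (1 - ramp t)) has_real_derivative
      0 - 2 * max 0 (1 - ramp t) * (0 - 2 * max 0 t)) (at t)"
    by (intro DERIV_diff DERIV_const DERIV_chain2[of ramp] DERIV_ramp)
  then show ?thesis by (simp add: cutoff_def[abs_def] cutoff_deriv_def mult_ac)
qed

lemma continuous_cutoff: "continuous_on A cutoff" and continuous_cutoff_deriv: "continuous_on A cutoff_deriv"
proof -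
  have ramp: "continuous_on B ramp" for B
    by (intro continuous_at_imp_continuous_on ballI DERIV_isCont[OF DERIV_ramp])
  show "continuous_on A cutoff"
    by (intro continuous_at_imp_continuous_on ballI DERIV_isCont[OF DERIV_cutoff])
  show "continuous_on A cutoff_deriv"
    unfolding cutoff_deriv_def by (intro continuous_intros ramp)
qed

lemma cutoff_deriv_bounds:
  "t \<ge> 1 \<Longrightarrow> cutoff_deriv t = 0" "\<bar>cutoff_deriv t\<bar> \<le> 4"
proof -
  show zero: "cutoff_deriv t = 0" if "t \<ge> 1"
    using ramp_ge_1[OF that] by (simp add: cutoff_deriv_def)
  show "\<bar>cutoff_deriv t\<bar> \<le> 4"
  proof (cases "t \<ge> 1")
    case False
    have "max 0 (1 - ramp t) * max 0 t \<le> 1 * 1"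
      using False by (intro mult_mono) auto
    then show ?thesis by (simp add: cutoff_deriv_def abs_mult)
  qed (simp add: zero)
qed

text \<open>
  A crude form of Jordan's inequality, from \<open>\<bar>sin t - t\<bar> \<le> \<bar>t\<bar>\<^sup>3 / 6\<close> and \<open>\<bar>t\<bar> \<le> pi / 2 < 2\<close>.
\<close>

lemma abs_sin_pi_ge: "\<bar>y\<bar> \<le> \<bar>sin (pi * y)\<bar>" if "\<bar>y\<bar> \<le> 1 / 2"
proof -
  define t where "t = pi * y"
  have "\<bar>t\<bar> = pi * \<bar>y\<bar>" by (simp add: t_def abs_mult)
  also have "\<dots> \<le> 4 * (1 / 2)" using that pi_less_4 by (intro mult_mono) auto
  finally have t: "\<bar>t\<bar> \<le> 2" by simp
  have "\<bar>sin t - (\<Sum>k<3. sin_coeff k * t ^ k)\<bar> \<le> inverse (fact 3) * \<bar>t\<bar> ^ 3"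
    by (rule Maclaurin_sin_bound)
  then have "\<bar>sin t - t\<bar> \<le> \<bar>t\<bar> ^ 3 / 6"
    by (simp add: numeral_3_eq_3 sin_coeff_def fact_numeral)
  moreover have "\<bar>t\<bar> ^ 3 \<le> 4 * \<bar>t\<bar>"
  proof -
    have "\<bar>t\<bar> * \<bar>t\<bar> \<le> 2 * 2" using t by (intro mult_mono) auto
    then have "(\<bar>t\<bar> * \<bar>t\<bar>) * \<bar>t\<bar> \<le> 4 * \<bar>t\<bar>" by (intro mult_right_mono) auto
    then show ?thesis by (simp add: power3_eq_cube)
  qed
  ultimately have "\<bar>t\<bar> / 3 \<le> \<bar>sin t\<bar>" by linarith
  moreover have "3 * \<bar>y\<bar> \<le> \<bar>t\<bar>"
    unfolding \<open>\<bar>t\<bar> = pi * \<bar>y\<bar>\<close> using pi_gt3 by (intro mult_right_mono) auto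
  ultimately show ?thesis by (simp add: t_def)
qed

lemma sin_pi_add_of_int_squared: "(sin (pi * (x + of_int k)))\<^sup>2 = (sin (pi * x))\<^sup>2"
proof -
  have "(cos (2 * (pi * (x + of_int k)))) = cos (2 * (pi * x))"
    using cos.plus_of_int[of "2 * pi * x" k] by (simp add: algebra_simps)
  then show ?thesis by (simp add: cos_double_sin)
qed

text \<open>
  Multiply \<open>f\<close> by a cutoff that vanishes at distance less than about \<open>\<eta>\<close> from \<open>p\<close> and is 1 at distance more
  than about \<open>2 * \<eta>\<close>.  The derivative of the cutoff is of order \<open>1 / \<eta>\<close>, but \<open>f\<close> is \<open>o(\<eta>)\<close> there,
  as \<open>f\<close> and \<open>f'\<close> vanish at \<open>p\<close>; so the change is small in the \<open>C\<^sup>1\<close> norm.  The role of the distance to \<open>p\<close> is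
  played by \<open>\<bar>sin (pi * (x - z))\<bar>\<close>, whose square is smooth and 1-periodic, which makes the
  perturbation a \<open>C\<^sup>1\<close> function on the circle at once.
\<close>

lemma nonhyperbolic_perturbation:
  assumes f: "f \<in> C1_circle" and p: "f p = 0" "circle_deriv f p = 0" and \<epsilon>: "\<epsilon> > 0"
  obtains g where "g \<in> C1_ball \<epsilon> f" "infinite (fixed_points g)"
proof -
  define z where "z = rep_circle p"
  have z: "circle_of z = p" by (simp add: z_def)
  let ?F = "\<lambda>x. f (circle_of x)" and ?F' = "\<lambda>x. circle_deriv f (circle_of x)"
  (* The change will be at most \<kappa> in value and 65 * \<kappa> in derivative. *)
  define \<kappa> where "\<kappa> = \<epsilon> / 70"
  have \<kappa>: "\<kappa> > 0" using \<epsilon> by (simp add: \<kappa>_def)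
  have "isCont ?F' z"
    using continuous_circle_deriv[OF f] by (auto simp: continuous_on_circle_iff continuous_on_eq_continuous_at)
  then obtain \<rho> where \<rho>: "\<rho> > 0" "\<And>x. \<bar>x - z\<bar> < \<rho> \<Longrightarrow> \<bar>?F' x\<bar> < \<kappa>"
    using \<kappa> z p unfolding continuous_at_eps_delta dist_real_def by (metis diff_zero)
  define \<sigma> where "\<sigma> x = sin (pi * (x - z))" for x
  have small: "\<bar>?F x\<bar> \<le> \<kappa> * \<bar>\<sigma> x\<bar> \<and> \<bar>?F' x\<bar> \<le> \<kappa>" if "\<bar>\<sigma> x\<bar> < \<rho>" for x
  proof -
    (* Reduce to the representative y of x that is nearest to z. *)
    define k where "k = round (x - z)"
    define y where "y = x - of_int k"
    have y: "\<bar>y - z\<bar> \<le> 1 / 2"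
      using of_int_round_abs_le[of "x - z"] by (simp add: y_def k_def abs_minus_commute algebra_simps)
    have xy: "circle_of x = circle_of y" by (simp add: y_def circle_of_eq_iff)
    have "(\<sigma> x)\<^sup>2 = (sin (pi * (y - z)))\<^sup>2"
      using sin_pi_add_of_int_squared[of "y - z" k] by (simp add: \<sigma>_def y_def)
    then have \<sigma>y: "\<bar>\<sigma> x\<bar> = \<bar>sin (pi * (y - z))\<bar>" by (simp add: power2_eq_iff abs_eq_iff)
    have yz: "\<bar>y - z\<bar> \<le> \<bar>\<sigma> x\<bar>" using abs_sin_pi_ge[OF y] \<sigma>y by simp
    have "norm (?F y - ?F z) \<le> \<kappa> * norm (y - z)"
    proof (rule field_differentiable_bound[of "ball z \<rho>" ?F ?F'])
      show "(?F has_real_derivative ?F' w) (at w within ball z \<rho>)" for w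
        by (rule DERIV_subset[OF C1_circle_deriv[OF f]]) simp
      show "norm (?F' w) \<le> \<kappa>" if "w \<in> ball z \<rho>" for w
        using \<rho>(2)[of w] that by (simp add: dist_real_def abs_minus_commute)
      show "y \<in> ball z \<rho>" "z \<in> ball z \<rho>"
        using yz that \<rho>(1) by (auto simp: dist_real_def)
    qed simp
    also have "\<dots> \<le> \<kappa> * \<bar>\<sigma> x\<bar>" using yz \<kappa> by simp
    finally have "\<bar>?F x\<bar> \<le> \<kappa> * \<bar>\<sigma> x\<bar>" by (simp add: z p xy)
    moreover have "\<bar>?F' x\<bar> \<le> \<kappa>"
      unfolding xy using \<rho>(2)[of y] yz that by auto
    ultimately show ?thesis by simp
  qed
  (* The cutoff differs from 1 only where (\<sigma> x)^2 < 2 * \<eta>^2 < \<rho>^2, so the estimate above applies there. *)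
  define \<eta> where "\<eta> = \<rho> / 2"
  have \<eta>: "\<eta> > 0" using \<rho> by (simp add: \<eta>_def)
  define T where "T x = (\<sigma> x)\<^sup>2 / \<eta>\<^sup>2 - 1" for x
  have T_per: "T x = T y" if xy: "x - y \<in> \<int>" for x y
  proof -
    obtain k where "x = y + of_int k" using xy by (metis Ints_cases add.commute diff_add_cancel)
    then show ?thesis
      using sin_pi_add_of_int_squared[of "y - z" k] by (simp add: T_def \<sigma>_def algebra_simps)
  qed
  define T' where "T' x = 2 * pi * \<sigma> x * cos (pi * (x - z)) / \<eta>\<^sup>2" for x
  have DT: "(T has_real_derivative T' x) (at x)" for x
  proof -
    have "((\<lambda>x. (\<sigma> x)\<^sup>2) has_real_derivative 2 * pi * \<sigma> x * cos (pi * (x - z))) (at x)"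
      unfolding \<sigma>_def by (auto intro!: derivative_eq_intros)
    from DERIV_diff[OF DERIV_cdivide[OF this] DERIV_const] show ?thesis
      unfolding T_def[abs_def] T'_def by simp
  qed
  define g where "g q = f q * cutoff (T (rep_circle q))" for q
  have g: "g (circle_of x) = ?F x * cutoff (T x)" for x
  proof -
    have "T (rep_circle (circle_of x)) = T x"
      by (rule T_per) (simp flip: circle_of_eq_iff)
    then show ?thesis by (simp add: g_def)
  qed
  define D where "D x = ?F' x * cutoff (T x) + cutoff_deriv (T x) * T' x * ?F x" for x
  have Dg: "((\<lambda>x. g (circle_of x)) has_real_derivative D x) (at x)" for x
    unfolding g D_def by (intro DERIV_mult C1_circle_deriv[OF f] DERIV_chain2[OF DERIV_cutoff DT])
  have cT: "continuous_on UNIV T" "continuous_on UNIV T'"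
    unfolding T_def[abs_def] T'_def[abs_def] \<sigma>_def using \<eta> by (auto intro!: continuous_intros)
  have cD: "continuous_on UNIV D"
    unfolding D_def[abs_def]
    using continuous_circle_deriv[OF f] continuous_C1_circle[OF f]
    by (auto intro!: continuous_intros cT continuous_on_compose2[OF continuous_cutoff cT(1)]
        continuous_on_compose2[OF continuous_cutoff_deriv cT(1)] simp: continuous_on_circle_iff)
  note gC = C1_circleI[of g, OF Dg cD]
  have bounds: "\<bar>?F x * cutoff (T x) - ?F x\<bar> \<le> \<kappa> \<and> \<bar>D x - ?F' x\<bar> \<le> 65 * \<kappa>" for x
  proof (cases "T x \<ge> 1")
    case True
    then show ?thesis using \<kappa> by (simp add: D_def cutoff_eq cutoff_deriv_bounds)
  next
    case False
    then have s: "(\<sigma> x)\<^sup>2 \<le> 2 * \<eta>\<^sup>2" using \<eta> by (simp add: T_def field_simps)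
    have "(\<sigma> x)\<^sup>2 < \<rho>\<^sup>2"
    proof -
      have "2 * (\<sigma> x)\<^sup>2 \<le> \<rho>\<^sup>2" using s by (simp add: \<eta>_def power_divide)
      moreover have "\<rho>\<^sup>2 > 0" using \<rho>(1) by simp
      ultimately show ?thesis by linarith
    qed
    then have "\<bar>\<sigma> x\<bar> < \<rho>" using \<rho>(1) by (intro power2_less_imp_less[of "\<bar>\<sigma> x\<bar>" \<rho>]) simp_all
    note sm = small[OF this]
    have \<sigma>1: "\<bar>\<sigma> x\<bar> \<le> 1" by (simp add: \<sigma>_def)
    have F: "\<bar>?F x\<bar> \<le> \<kappa>"
      using sm mult_left_mono[OF \<sigma>1, of \<kappa>] \<kappa> by linarith
    have "?F x * cutoff (T x) - ?F x = ?F x * (cutoff (T x) - 1)" by (simp add: algebra_simps)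
    then have 1: "\<bar>?F x * cutoff (T x) - ?F x\<bar> \<le> \<kappa> * 1"
      unfolding abs_mult using F cutoff_bounds[of "T x"] by (simp only: abs_mult) (intro mult_mono, auto)
    have 2: "\<bar>?F' x * (cutoff (T x) - 1)\<bar> \<le> \<kappa> * 1"
      unfolding abs_mult using sm cutoff_bounds[of "T x"] by (intro mult_mono) auto
    have "\<bar>T' x\<bar> \<le> 8 * \<bar>\<sigma> x\<bar> / \<eta>\<^sup>2"
    proof -
      have "\<bar>2 * pi * \<sigma> x * cos (pi * (x - z))\<bar> \<le> 8 * \<bar>\<sigma> x\<bar> * 1"
        unfolding abs_mult using pi_less_4 by (intro mult_mono) auto
      then show ?thesis using \<eta> by (simp add: T'_def abs_mult divide_right_mono)
    qed
    then have "\<bar>T' x\<bar> * \<bar>?F x\<bar> \<le> 8 * \<bar>\<sigma> x\<bar> / \<eta>\<^sup>2 * (\<kappa> * \<bar>\<sigma> x\<bar>)"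
      using sm by (intro mult_mono) auto
    also have "\<dots> = 8 * \<kappa> * ((\<sigma> x)\<^sup>2 / \<eta>\<^sup>2)" by (simp add: power2_eq_square)
    also have "\<dots> \<le> 8 * \<kappa> * 2"
      using s \<eta> \<kappa> by (intro mult_left_mono) (auto simp: field_simps)
    finally have T'F: "\<bar>T' x\<bar> * \<bar>?F x\<bar> \<le> 16 * \<kappa>" by simp
    have "\<bar>cutoff_deriv (T x)\<bar> * (\<bar>T' x\<bar> * \<bar>?F x\<bar>) \<le> 4 * (16 * \<kappa>)"
      by (rule mult_mono) (use T'F cutoff_deriv_bounds(2)[of "T x"] in auto)
    then have 3: "\<bar>cutoff_deriv (T x) * T' x * ?F x\<bar> \<le> 64 * \<kappa>" by (simp add: abs_mult mult.assoc)
    have "D x - ?F' x = ?F' x * (cutoff (T x) - 1) + cutoff_deriv (T x) * T' x * ?F x"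
      by (simp add: D_def algebra_simps)
    then have "\<bar>D x - ?F' x\<bar> \<le> 65 * \<kappa>" using 2 3 by linarith
    with 1 show ?thesis by simp
  qed
  have "g \<in> C1_ball \<epsilon> f"
  proof (rule C1_ballI[OF f gC(1)])
    fix q
    have "\<bar>g (circle_of x) - f (circle_of x)\<bar> \<le> \<kappa>"
      "\<bar>circle_deriv g (circle_of x) - circle_deriv f (circle_of x)\<bar> \<le> 65 * \<kappa>" for x
      using bounds[of x] by (simp_all add: g gC(2))
    from this[of "rep_circle q"] show "\<bar>g q - f q\<bar> \<le> \<kappa>" "\<bar>circle_deriv g q - circle_deriv f q\<bar> \<le> 65 * \<kappa>"
      by simp_all
  qed (use \<epsilon> in \<open>simp add: \<kappa>_def\<close>)
  moreover have "infinite (fixed_points g)"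
  proof -
    let ?I = "{z<..<z + min (\<eta> / 4) 1}"
    have "circle_of ` ?I \<subseteq> fixed_points g"
    proof
      fix q assume "q \<in> circle_of ` ?I"
      then obtain x where x: "q = circle_of x" "x \<in> ?I" by blast
      have "\<bar>\<sigma> x\<bar> \<le> \<bar>pi * (x - z)\<bar>" unfolding \<sigma>_def by (rule abs_sin_x_le_abs_x)
      also have "\<dots> \<le> 4 * (\<eta> / 4)"
        unfolding abs_mult using x(2) pi_less_4 by (intro mult_mono) auto
      finally have "(\<sigma> x)\<^sup>2 \<le> \<eta>\<^sup>2" using \<eta> by (simp add: abs_le_square_iff[symmetric])
      then have "T x \<le> 0" using \<eta> by (simp add: T_def)
      then show "q \<in> fixed_points g" by (simp add: fixed_points_def x(1) g cutoff_eq)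
    qed
    moreover have "inj_on circle_of ?I"
    proof (rule inj_onI)
      fix x y assume xy: "x \<in> ?I" "y \<in> ?I" "circle_of x = circle_of y"
      then obtain k where k: "x - y = of_int k" by (auto simp: circle_of_eq_iff elim: Ints_cases)
      have "\<bar>x - y\<bar> < 1" using xy by (auto simp: abs_less_iff)
      then have "k = 0" unfolding k by linarith
      then show "x = y" using k by simp
    qed
    moreover have "infinite ?I" using \<eta> by (intro infinite_Ioo) simp
    ultimately show ?thesis by (meson finite_imageD finite_subset)
  qed
  ultimately show thesis by (rule that)
qed

text \<open>
  A perturbation with finitely many fixed points always exists, and one with infinitely many exists
  if some fixed point is nonhyperbolic; they cannot both be equivalent to \<open>f\<close>.
\<close>

lemma stable_imp_finite_hyperbolic:
  assumes f: "f \<in> C1_circle" and stable: "C1_structurally_stable f"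
  shows "finite (fixed_points f) \<and> (\<forall>p\<in>fixed_points f. hyperbolic f p)"
proof -
  obtain b :: real where b: "b > 0"
    "\<And>\<epsilon>. 0 < \<epsilon> \<Longrightarrow> \<epsilon> < b \<Longrightarrow> (\<forall>g\<in>C1_ball \<epsilon> f. topologically_equivalent f g)"
    using stable unfolding C1_structurally_stable_def eventually_at_right_field by blast
  define \<epsilon> where "\<epsilon> = b / 2"
  have \<epsilon>: "\<epsilon> > 0" and equiv: "\<And>g. g \<in> C1_ball \<epsilon> f \<Longrightarrow> topologically_equivalent f g"
    using b(1) b(2)[of "b / 2"] by (auto simp: \<epsilon>_def)
  (* The zeros of f - c are the points where f = c, and c is a regular value. *)
  obtain c where c: "- \<epsilon> < c" "c < 0" "\<And>x. f (circle_of x) = c \<Longrightarrow> circle_deriv f (circle_of x) \<noteq> 0"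
    using regular_value_exists[OF C1_circle_deriv[OF f], of "- \<epsilon>" 0] \<epsilon> by auto
  define g where "g p = f p - c" for p
  have Dg: "((\<lambda>x. g (circle_of x)) has_real_derivative circle_deriv f (circle_of x)) (at x)" for x
    unfolding g_def by (auto intro!: derivative_eq_intros C1_circle_deriv[OF f])
  note gC = C1_circleI[of g, OF Dg continuous_circle_deriv[OF f, unfolded continuous_on_circle_iff]]
  have g': "circle_deriv g p = circle_deriv f p" for p
    using gC(2)[of "rep_circle p"] by simp
  have "g \<in> C1_ball \<epsilon> f"
    by (rule C1_ballI[OF f gC(1), where a="\<bar>c\<bar>" and b=0]) (use c in \<open>auto simp: g' g_def\<close>)
  moreover have "\<forall>p\<in>fixed_points g. hyperbolic g p"
    using c(3)[of "rep_circle p" for p] by (simp add: fixed_points_def hyperbolic_def g_def g')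
  then have "finite (fixed_points g)" by (rule finite_hyperbolic_fixed_points[OF gC(1)])
  ultimately have fin: "finite (fixed_points f)"
    using finite_fixed_points_equivalent equiv by blast
  moreover have "hyperbolic f p" if "p \<in> fixed_points f" for p
  proof (rule ccontr)
    assume "\<not> hyperbolic f p"
    then obtain g where g: "g \<in> C1_ball \<epsilon> f" "infinite (fixed_points g)"
      using nonhyperbolic_perturbation[OF f _ _ \<epsilon>] \<open>p \<in> fixed_points f\<close>
      by (auto simp: fixed_points_def hyperbolic_def)
    then show False using finite_fixed_points_equivalent equiv fin by blast
  qed
  ultimately show ?thesis by blast
qed

theorem theorem1:
  fixes f :: "circle \<Rightarrow> real"
  assumes "f \<in> C1_circle"
  shows "C1_structurally_stable f \<longleftrightarrow>
         finite (fixed_points f) \<and> (\<forall>p \<in> fixed_points f. hyperbolic f p)"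
  using stable_imp_finite_hyperbolic[OF assms] hyperbolic_imp_stable[OF assms] by blast

end
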